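(* Let $A$ be a positive semidefinite (complex Hermitian) $d\times d$ matrix and let $n\ge1$. Then: (a) $\overline{S}_\alpha(A)\le\overline{S}_\beta(A)$ for any $\alpha,\beta\in\mathbb{N}^n$ such that $|\alpha|=|\beta|=d$ and $\beta\prec\alpha$; (b) whenever $\alpha=(\alpha_1,\ldots,\alpha_n)\in\mathbb{N}^n$ and $i,j\in\{1,\ldots,n\}$ are such that $|\alpha|=d$, $\alpha_i\ge\alpha_j>0$, and $k$ is an integer with $-\alpha_i+1\le k\le\alpha_j-1$, one has $$\overline{S}_{\alpha+k(e_i-e_j)}(A)^2\ \ge\ \overline{S}_{\alpha+(k-1)(e_i-e_j)}(A)\;\overline{S}_{\alpha+(k+1)(e_i-e_j)}(A).$$
   Context: $\mathbb{N}$ is the set of nonnegative integers, $|\alpha|=\sum_{i=1}^n\alpha_i$, and $\{e_i\}_{i=1}^n$ is the standard basis of $\mathbb{R}^n$. $A[\mathcal{S}]$ denotes the principal submatrix of $A$ with rows and columns indexed by $\mathcal{S}\subseteq\{1,\ldots,d\}$, with $\det(A[\emptyset])=1$. For $\alpha\in\mathbb{N}^n$ with $|\alpha|=d$ and a matrix $A$ of order $d$, $$S_\alpha(A)=\sum_{(\mathcal{S}_1,\ldots,\mathcal{S}_n)}\prod_{i=1}^n\det(A[\mathcal{S}_i]),$$ where the sum is over all $n$-tuples $(\mathcal{S}_1,\ldots,\mathcal{S}_n)$ of pairwise disjoint (possibly empty) subsets with union $\{1,\ldots,d\}$ such that $|\mathcal{S}_i|=\alpha_i$ for $1\le i\le n$;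 the average Fischer product is $\overline{S}_\alpha(A)=\binom{d}{\alpha}^{-1}S_\alpha(A)$, where $\binom d\alpha=\frac{d!}{\alpha_1!\cdots\alpha_n!}$. Majorization: for $x,y\in\mathbb{R}^n$, $x\prec y$ means $\sum_{i=1}^k x_{[i]}\le\sum_{i=1}^k y_{[i]}$ for $1\le k\le n$ with equality for $k=n$, where $w_{[1]}\ge\cdots\ge w_{[n]}$ is the decreasing rearrangement of $w$. *)

theory Defs
  imports
    "Jordan_Normal_Form.Schur_Decomposition"
    "Jordan_Normal_Form.DL_Submatrix"
    "HOL-Library.Disjoint_Sets"
    "HOL-Library.FuncSet"
begin

text \<open>
  Indices are zero-based: rows and columns of a matrix of order \<open>d\<close> are indexed by
  \<open>{..<d}\<close>, and a vector with \<open>n\<close> entries is a function on \<open>nat\<close> of which only the values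
  on \<open>{..<n}\<close> matter.

  The order on \<open>complex\<close> is that of Complex-Order: \<open>x \<le> y\<close> means \<open>Re x \<le> Re y\<close> and
  \<open>Im x = Im y\<close>; in particular \<open>0 \<le> x\<close> says that \<open>x\<close> is real and nonnegative.
\<close>

text \<open>The term \<open>(A *\<^sub>v v) \<bullet>c v\<close> is the Hermitian form of \<open>A\<close> at \<open>v\<close>, since \<open>\<bullet>c\<close>
  conjugates its second argument.\<close>

definition positive_semidefinite :: "complex mat \<Rightarrow> bool" where
  "positive_semidefinite A \<longleftrightarrow>
     square_mat A \<and> mat_adjoint A = A \<and>
     (\<forall>v \<in> carrier_vec (dim_row A). 0 \<le> (A *\<^sub>v v) \<bullet>c v)"

text \<open>Ordered \<open>n\<close>-tuples of pairwise disjoint, possibly empty sets of prescribed sizes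
  with union \<open>{..<d}\<close>. Tuples are extensional functions on \<open>{..<n}\<close>, so that each tuple is
  represented once.\<close>

definition ordered_partitions :: "nat \<Rightarrow> nat \<Rightarrow> (nat \<Rightarrow> nat) \<Rightarrow> (nat \<Rightarrow> nat set) set" where
  "ordered_partitions d n \<alpha> =
     {S \<in> {..<n} \<rightarrow>\<^sub>E Pow {..<d}.
        disjoint_family_on S {..<n} \<and> (\<Union>i<n. S i) = {..<d} \<and> (\<forall>i<n. card (S i) = \<alpha> i)}"

definition fischer_sum :: "nat \<Rightarrow> (nat \<Rightarrow> nat) \<Rightarrow> complex mat \<Rightarrow> complex" where
  "fischer_sum n \<alpha> A =
     (\<Sum>S \<in> ordered_partitions (dim_row A) n \<alpha>. \<Prod>i<n. det (submatrix A (S i) (S i)))"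

definition multinomial :: "nat \<Rightarrow> (nat \<Rightarrow> nat) \<Rightarrow> 'a :: field_char_0" where
  "multinomial n \<alpha> = fact (\<Sum>i<n. \<alpha> i) / (\<Prod>i<n. fact (\<alpha> i))"

definition avg_fischer_product :: "nat \<Rightarrow> (nat \<Rightarrow> nat) \<Rightarrow> complex mat \<Rightarrow> complex" where
  "avg_fischer_product n \<alpha> A = inverse (multinomial n \<alpha>) * fischer_sum n \<alpha> A"

definition decreasing_rearrangement :: "nat \<Rightarrow> (nat \<Rightarrow> real) \<Rightarrow> nat \<Rightarrow> real" where
  "decreasing_rearrangement n w i = rev (sort (map w [0..<n])) ! i"

definition majorized_by :: "nat \<Rightarrow> (nat \<Rightarrow> real) \<Rightarrow> (nat \<Rightarrow> real) \<Rightarrow> bool" where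
  "majorized_by n x y \<longleftrightarrow>
     (\<forall>k \<in> {1..n}. (\<Sum>i<k. decreasing_rearrangement n x i)
                     \<le> (\<Sum>i<k. decreasing_rearrangement n y i)) \<and>
     (\<Sum>i<n. decreasing_rearrangement n x i) = (\<Sum>i<n. decreasing_rearrangement n y i)"

definition unit_vector :: "nat \<Rightarrow> nat \<Rightarrow> int" where
  "unit_vector i l = (if l = i then 1 else 0)"

text \<open>The vector \<open>\<alpha> + k (e\<^sub>i - e\<^sub>j)\<close>; the conversion \<open>nat\<close> only has its intended meaning
  if this vector has no negative entries.\<close>

definition shift :: "(nat \<Rightarrow> nat) \<Rightarrow> int \<Rightarrow> nat \<Rightarrow> nat \<Rightarrow> (nat \<Rightarrow> nat)" where
  "shift \<alpha> k i j = (\<lambda>l. nat (int (\<alpha> l) + k * (unit_vector i l - unit_vector j l)))"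

end

theory Submission
  imports Defs
begin

text \<open>
  Put \<open>T(\<alpha>) = \<alpha>! S\<^sub>\<alpha>(A)\<close>, which is \<open>d!\<close> times the average Fischer product.  For positive definite \<open>A\<close>
  the generating function \<open>P(z) = \<Sum>\<^sub>\<alpha> S\<^sub>\<alpha>(A) z\<^sup>\<alpha>\<close> is the coefficient of \<open>\<Prod>\<^sub>j x\<^sub>j\<^sup>n\<^sup>-\<^sup>1\<close> in
  \<open>\<Prod>\<^sub>i det (diag(x) + z\<^sub>i A)\<close>, and it has no zero with all \<open>z\<^sub>i\<close> in the open upper half plane:  the
  product has none as long as the \<open>x\<^sub>j\<close> lie in the closed half plane, and the coefficients are extracted
  one variable at a time, since a polynomial of degree \<open>n\<close> with all roots in the lower half plane has a
  nonzero coefficient in degree \<open>n - 1\<close>.  By the Gauss-Lucas argument the partial derivatives of \<open>P\<close> are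
  again free of zeros.  Those of order \<open>d - 2\<close> are real quadratic forms with Hessian entries
  \<open>T(\<gamma> + e\<^sub>k + e\<^sub>l)\<close>, and their discriminants give
  \<open>T(\<gamma> + e\<^sub>i + e\<^sub>j)\<^sup>2 \<ge> T(\<gamma> + 2 e\<^sub>i) T(\<gamma> + 2 e\<^sub>j)\<close>, which is (b).  As \<open>T\<close> is positive and symmetric,
  log-concavity shows that moving a unit from a larger to a smaller entry does not decrease \<open>T\<close>, and (a)
  follows because majorization is generated by such moves.  Semidefinite matrices are limits of \<open>A + \<epsilon> I\<close>.
\<close>

section \<open>Stable polynomials and log-concavity\<close>

text \<open>The logarithmic derivative is the sum of 1/(t - r) over the roots r, and every t - r
  lies in the upper half plane, so each summand has negative imaginary part. This is the Gauss-Lucas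
  step: \<open>pderiv p\<close> cannot vanish at \<open>t\<close>.\<close>

lemma Im_logderiv_neg:
  fixes p :: "complex poly"
  assumes "degree p > 0" "\<And>r. poly p r = 0 \<Longrightarrow> Im r \<le> 0" "Im t > 0"
  shows "Im (poly (pderiv p) t / poly p t) < 0"
  using assms
proof (induction "degree p" arbitrary: p)
  case 0
  then show ?case by simp
next
  case (Suc m)
  have "\<not> constant (poly p)" using Suc.prems(1) by (simp add: constant_degree)
  then obtain r where r: "poly p r = 0" using fundamental_theorem_of_algebra by blast
  then obtain q where q: "p = [:- r, 1:] * q" by (metis dvdE poly_eq_0_iff_dvd)
  have q0: "q \<noteq> 0" using q Suc.prems(1) by auto
  have dq: "degree p = Suc (degree q)" unfolding q using q0 by (subst degree_mult_eq) auto
  have tr: "Im (t - r) > 0" using Suc.prems(2)[OF r] Suc.prems(3) by simp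
  have qt: "poly q t \<noteq> 0" using Suc.prems(2)[of t] Suc.prems(3) q by fastforce
  have tr0: "t - r \<noteq> 0" using tr by auto
  have "poly (pderiv p) t / poly p t = 1 / (t - r) + poly (pderiv q) t / poly q t"
  proof -
    have "pderiv p = q + [:- r, 1:] * pderiv q"
      unfolding q pderiv_mult by (simp add: pderiv_pCons)
    then have "poly (pderiv p) t = poly (q + [:- r, 1:] * pderiv q) t" by (simp only:)
    then have "poly (pderiv p) t = poly q t + (t - r) * poly (pderiv q) t"
      by (simp only: poly_add poly_mult) simp
    moreover have "poly p t = (t - r) * poly q t" unfolding q by (simp add: algebra_simps)
    ultimately show ?thesis using tr0 qt by (simp add: divide_simps)
  qed
  moreover have "Im (1 / (t - r)) < 0" using tr
    by (simp add: Im_divide) (smt (verit) divide_neg_pos sum_power2_gt_zero_iff)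
  moreover have "Im (poly (pderiv q) t / poly q t) \<le> 0"
  proof (cases "degree q = 0")
    case True
    then have "pderiv q = 0" by (simp add: pderiv_eq_0_iff)
    then show ?thesis by simp
  next
    case False
    have "poly q s = 0 \<Longrightarrow> Im s \<le> 0" for s using Suc.prems(2)[of s] q by simp
    then show ?thesis using Suc.hyps(1)[of q] False Suc.hyps(2) dq Suc.prems(3) by fastforce
  qed
  ultimately show ?case by simp
qed

text \<open>By Vieta the ratio is minus the sum of the roots. It serves to show that
  \<open>coeff p n\<close> is nonzero.\<close>

lemma Im_coeff_ratio_pos:
  fixes p :: "complex poly"
  assumes "degree p = Suc n" "\<And>r. poly p r = 0 \<Longrightarrow> Im r < 0"
  shows "Im (coeff p n / coeff p (Suc n)) > 0"
  using assms
proof (induction n arbitrary: p)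
  case (0 p)
  have "\<not> constant (poly p)" using 0 by (simp add: constant_degree)
  then obtain r where r: "poly p r = 0" using fundamental_theorem_of_algebra by blast
  then obtain q where q: "p = [:- r, 1:] * q" by (metis dvdE poly_eq_0_iff_dvd)
  have q0: "q \<noteq> 0" using q 0 by auto
  have "degree p = Suc (degree q)" unfolding q using q0 by (subst degree_mult_eq) auto
  then have "degree q = 0" using 0 by simp
  then obtain c where c: "q = [:c:]" "c \<noteq> 0" using q0 by (metis degree_eq_zeroE pCons_0_0)
  show ?case using 0(2)[OF r] c unfolding q by simp
next
  case (Suc n p)
  have "\<not> constant (poly p)" using Suc by (simp add: constant_degree)
  then obtain r where r: "poly p r = 0" using fundamental_theorem_of_algebra by blast
  then obtain q where q: "p = [:- r, 1:] * q" by (metis dvdE poly_eq_0_iff_dvd)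
  have q0: "q \<noteq> 0" using q Suc by auto
  have "degree p = Suc (degree q)" unfolding q using q0 by (subst degree_mult_eq) auto
  then have dq: "degree q = Suc n" using Suc by simp
  have IH: "Im (coeff q n / coeff q (Suc n)) > 0"
    by (rule Suc.IH[OF dq]) (use Suc.prems(2) q in auto)
  have l: "coeff q (Suc n) \<noteq> 0" using dq q0 by (metis leading_coeff_0_iff)
  have z: "coeff q (Suc (Suc n)) = 0" using dq by (simp add: coeff_eq_0)
  have "coeff p (Suc n) / coeff p (Suc (Suc n)) = coeff q n / coeff q (Suc n) - r"
    unfolding q using l z by (simp add: field_simps)
  then show ?case using IH Suc.prems(2)[OF r] by simp
qed

section \<open>Homogeneous forms and their partial derivatives\<close>

text \<open>With \<open>Q(z) = \<Sum>\<^sub>\<alpha> T(\<alpha>) z\<^sup>\<alpha> / \<alpha>!\<close>, \<open>|\<alpha>| = d\<close>, and \<open>|\<gamma>| + e = d\<close>, this is \<open>e!\<close> times the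
  derivative of \<open>Q\<close> of order \<open>\<gamma>\<close>; the recursion runs over words of length \<open>e\<close> in the variables.\<close>

fun weighted_sum :: "nat \<Rightarrow> ((nat \<Rightarrow> nat) \<Rightarrow> complex) \<Rightarrow> nat \<Rightarrow> (nat \<Rightarrow> nat) \<Rightarrow> (nat \<Rightarrow> complex) \<Rightarrow> complex"
  where
    "weighted_sum n T 0 \<gamma> z = T \<gamma>"
  | "weighted_sum n T (Suc e) \<gamma> z = (\<Sum>l<n. z l * weighted_sum n T e (\<gamma>(l := Suc (\<gamma> l))) z)"

text \<open>Freezing all variables but \<open>z l\<close> makes the one-variable lemmas applicable.
  Only the word made of e letters \<open>l\<close> contributes in degree \<open>e\<close>, which
  identifies the coefficient there.\<close>

lemma weighted_sum_poly:
  assumes "l < n"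
  shows "\<exists>p. (\<forall>t. poly p t = weighted_sum n T e \<gamma> (z(l := t))) \<and> degree p \<le> e \<and>
    coeff p e = T (\<gamma>(l := \<gamma> l + e))"
proof (induction e arbitrary: \<gamma>)
  case 0
  show ?case by (rule exI[of _ "[:T \<gamma>:]"]) simp
next
  case (Suc e)
  then obtain P where P: "poly (P \<gamma>) t = weighted_sum n T e \<gamma> (z(l := t))" "degree (P \<gamma>) \<le> e"
    "coeff (P \<gamma>) e = T (\<gamma>(l := \<gamma> l + e))" for \<gamma> t by metis
  let ?Q = "\<lambda>k. P (\<gamma>(k := Suc (\<gamma> k)))"
  let ?p = "pCons 0 (?Q l) + (\<Sum>k\<in>{..<n} - {l}. smult (z k) (?Q k))"
  have "poly ?p t = weighted_sum n T (Suc e) \<gamma> (z(l := t))" for t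
    using assms by (simp add: poly_sum P sum.remove[of "{..<n}" l])
  moreover have dr: "degree (\<Sum>k\<in>{..<n} - {l}. smult (z k) (?Q k)) \<le> e"
    by (intro degree_sum_le) (auto intro: P order.trans[OF degree_smult_le])
  moreover have "degree (pCons 0 (?Q l)) \<le> Suc e"
    using P(2)[of "\<gamma>(l := Suc (\<gamma> l))"] by (simp add: degree_pCons_eq_if)
  ultimately have d: "degree ?p \<le> Suc e" by (meson degree_add_le le_Suc_eq)
  have "coeff ?p (Suc e) = T (\<gamma>(l := \<gamma> l + Suc e))"
    using dr by (simp add: P coeff_eq_0)
  with d \<open>\<And>t. poly ?p t = _\<close> show ?case by blast
qed

text \<open>In a word of length e + 1 the derivative may strike any of the e + 1 letters, and every
  position gives the same sum.\<close>

lemma weighted_sum_deriv: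
  assumes "l < n"
  shows "((\<lambda>t. weighted_sum n T (Suc e) \<gamma> (z(l := t))) has_field_derivative
    of_nat (Suc e) * weighted_sum n T e (\<gamma>(l := Suc (\<gamma> l))) (z(l := t))) (at t)"
proof (induction e arbitrary: \<gamma>)
  case 0
  have "(\<lambda>t. weighted_sum n T (Suc 0) \<gamma> (z(l := t))) = (\<lambda>t. t * T (\<gamma>(l := Suc (\<gamma> l)))
     + (\<Sum>k\<in>{..<n} - {l}. z k * T (\<gamma>(k := Suc (\<gamma> k)))))"
    using assms by (auto simp: sum.remove[of "{..<n}" l] fun_eq_iff)
  then show ?case by (auto intro!: derivative_eq_intros simp: fun_upd_def)
next
  case (Suc e)
  let ?g = "\<lambda>k. \<gamma>(k := Suc (\<gamma> k))"
  let ?w = "\<lambda>k t. weighted_sum n T (Suc e) (?g k) (z(l := t))"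
  let ?w' = "\<lambda>k. of_nat (Suc e) * weighted_sum n T e ((?g l)(k := Suc (?g l k))) (z(l := t))"
  have comm: "(?g k)(l := Suc (?g k l)) = (?g l)(k := Suc (?g l k))" for k
    by (auto simp: fun_eq_iff)
  have d: "((\<lambda>t. ?w k t) has_field_derivative ?w' k) (at t)" for k
    using Suc[of "?g k"] unfolding comm .
  have "((\<lambda>t. \<Sum>k<n. (z(l := t)) k * ?w k t) has_field_derivative
     (\<Sum>k<n. (if k = l then 1 else 0) * ?w k t + ?w' k * (z(l := t)) k)) (at t)"
    by (intro DERIV_sum DERIV_mult d) (auto intro!: derivative_eq_intros)
  also have "(\<Sum>k<n. (if k = l then 1 else 0) * ?w k t + ?w' k * (z(l := t)) k) =
     ?w l t + (\<Sum>k<n. ?w' k * (z(l := t)) k)"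
  proof -
    have "(\<Sum>k<n. (if k = l then 1 else 0) * f k) = f l" for f :: "nat \<Rightarrow> complex"
      using assms by (simp add: sum.remove[of "{..<n}" l])
    then show ?thesis by (simp only: sum.distrib)
  qed
  \<comment> \<open>The terms in which a later letter is struck recombine, by the recursion of
    \<open>weighted_sum\<close>, into e + 1 copies of \<open>?w l t\<close>; the first letter
    supplies one more.\<close>
  also have "(\<Sum>k<n. ?w' k * (z(l := t)) k) = of_nat (Suc e) * ?w l t"
    by (simp only: weighted_sum.simps sum_distrib_left) (simp add: algebra_simps)
  also have "?w l t + of_nat (Suc e) * ?w l t = of_nat (Suc (Suc e)) * ?w l t"
    by (simp add: algebra_simps)
  finally show ?case by (simp only: weighted_sum.simps)
qed

text \<open>The three points are built upwards from a common \<open>\<gamma>\<close> of weight d -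
  2. This avoids truncated subtraction, and \<open>\<gamma>\<close> is the order of the derivative
  that yields the inequality.\<close>

definition log_concave_on :: "nat \<Rightarrow> nat \<Rightarrow> ((nat \<Rightarrow> nat) \<Rightarrow> real) \<Rightarrow> bool" where
  "log_concave_on d n T \<longleftrightarrow> (\<forall>\<gamma> i j. i < n \<longrightarrow> j < n \<longrightarrow> i \<noteq> j \<longrightarrow> (\<Sum>l<n. \<gamma> l) + 2 = d \<longrightarrow>
    T (\<gamma>(i := \<gamma> i + 2)) * T (\<gamma>(j := \<gamma> j + 2)) \<le> (T (\<gamma>(i := \<gamma> i + 1, j := \<gamma> j + 1)))\<^sup>2)"

lemma sum_fun_upd_add:
  fixes \<gamma> :: "nat \<Rightarrow> nat"
  assumes "l < n"
  shows "(\<Sum>k<n. (\<gamma>(l := \<gamma> l + e)) k) = (\<Sum>k<n. \<gamma> k) + e"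
  using assms by (simp add: sum.remove[of "{..<n}" l])

text \<open>The order \<open>\<gamma>\<close> is reached from 0 by one derivative at a time, and
  \<open>Im_logderiv_neg\<close>, applied in the variable concerned, shows that each of them keeps
  the form free of zeros.\<close>

lemma weighted_sum_stable:
  fixes T :: "(nat \<Rightarrow> nat) \<Rightarrow> complex"
  assumes "\<And>\<alpha>. (\<Sum>l<n. \<alpha> l) = d \<Longrightarrow> T \<alpha> \<noteq> 0"
    and "\<And>z. (\<And>l. l < n \<Longrightarrow> Im (z l) > 0) \<Longrightarrow> weighted_sum n T d (\<lambda>_. 0) z \<noteq> 0"
    and "\<And>l. l \<ge> n \<Longrightarrow> \<gamma> l = 0"
    and "(\<Sum>l<n. \<gamma> l) + e = d" and "\<And>l. l < n \<Longrightarrow> Im (z l) > 0"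
  shows "weighted_sum n T e \<gamma> z \<noteq> 0"
  using assms(3-5)
proof (induction "\<Sum>l<n. \<gamma> l" arbitrary: \<gamma> e z)
  case 0
  \<comment> \<open>Vanishing from \<open>n\<close> on makes \<open>\<gamma>\<close> the zero
    function itself, which is what the stability assumption is about.\<close>
  have "\<gamma> l = 0" for l using 0 by (cases "l < n") auto
  then have "\<gamma> = (\<lambda>_. 0)" by (simp add: fun_eq_iff)
  then show ?case using assms(2) 0 by simp
next
  case (Suc s)
  then obtain l where l: "l < n" "\<gamma> l > 0"
    by (metis gr0I lessThan_iff nat.distinct(1) sum.neutral)
  define \<gamma>' where "\<gamma>' = \<gamma>(l := \<gamma> l - 1)"
  have \<gamma>: "\<gamma> = \<gamma>'(l := Suc (\<gamma>' l))" using l by (auto simp: \<gamma>'_def)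
  have s: "(\<Sum>l<n. \<gamma>' l) = s" using sum_fun_upd_add[OF l(1), of \<gamma>' 1] Suc.hyps(2) \<gamma> by simp
  have nz: "weighted_sum n T (Suc e) \<gamma>' (z(l := t)) \<noteq> 0" if "Im t > 0" for t
    using that Suc.prems Suc.hyps(2) s by (intro Suc.hyps(1)) (auto simp: \<gamma>'_def)
  obtain p where p: "\<And>t. poly p t = weighted_sum n T (Suc e) \<gamma>' (z(l := t))"
    "coeff p (Suc e) = T (\<gamma>'(l := \<gamma>' l + Suc e))"
    using weighted_sum_poly[OF l(1)] by blast
  \<comment> \<open>As \<open>T\<close> has no zero of weight d, the restriction to one variable is
    not constant.\<close>
  have "coeff p (Suc e) \<noteq> 0" unfolding p
    by (rule assms(1), subst sum_fun_upd_add[OF l(1)]) (use s Suc in simp)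
  then have deg: "degree p > 0" using le_degree by fastforce
  have "poly (pderiv p) (z l) = of_nat (Suc e) * weighted_sum n T e \<gamma> z"
    using DERIV_unique[OF poly_DERIV[of p "z l"]] weighted_sum_deriv[OF l(1), of T e \<gamma>' z "z l"]
    by (simp add: p \<gamma>[symmetric] fun_upd_triv del: weighted_sum.simps of_nat_Suc)
  moreover have "Im (poly (pderiv p) (z l) / poly p (z l)) < 0"
    using deg nz p Suc.prems(3) l by (intro Im_logderiv_neg) (auto intro: leI)
  ultimately show ?case by auto
qed

section \<open>Real quadratic forms without zeros in the upper half plane\<close>

lemma quadratic_upper_root:
  fixes a b c :: real
  assumes "b\<^sup>2 < a * c"
  obtains t :: complex where "Im t > 0" "of_real a + 2 * of_real b * t + of_real c * t\<^sup>2 = 0"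
proof -
  have c: "c \<noteq> 0" using assms by auto
  \<comment> \<open>Dividing by |c| instead of c selects the root in the upper half plane for either
    sign of \<open>c\<close>.\<close>
  define s where "s = sqrt (a * c - b\<^sup>2) / \<bar>c\<bar>"
  define t where "t = Complex (- b / c) s"
  have s: "s > 0" using assms c by (simp add: s_def)
  have s2: "s\<^sup>2 = (a * c - b\<^sup>2) / c\<^sup>2" using assms by (simp add: s_def power_divide)
  have "of_real a + 2 * of_real b * t + of_real c * t\<^sup>2 = 0"
  proof (rule complex_eqI)
    have "c * s\<^sup>2 = (a * c - b\<^sup>2) / c" unfolding s2 using c by (simp add: power2_eq_square)
    moreover have "Re (t\<^sup>2) = (b / c)\<^sup>2 - s\<^sup>2" by (simp add: t_def power2_eq_square)
    moreover have "Re (of_real a + 2 * of_real b * t + of_real c * t\<^sup>2) = a - 2 * b * b / c + c * Re (t\<^sup>2)"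
      by (simp add: t_def)
    ultimately have "Re (of_real a + 2 * of_real b * t + of_real c * t\<^sup>2) =
        a - 2 * b * b / c + (c * (b / c)\<^sup>2 - (a * c - b\<^sup>2) / c)"
      by (simp add: right_diff_distrib)
    then show "Re (of_real a + 2 * of_real b * t + of_real c * t\<^sup>2) = Re 0"
      using c by (simp add: power2_eq_square field_simps)
    show "Im (of_real a + 2 * of_real b * t + of_real c * t\<^sup>2) = Im 0"
      using c by (simp add: t_def power2_eq_square field_simps)
  qed
  then show ?thesis using that[of t] s by (simp add: t_def)
qed

text \<open>The rays through 1 and \<open>t\<close> span an angle below pi, so a slight turn moves
  both into the open upper half plane: for w = 1 + \<delta> i the imaginary part of w t is Im t +
  \<delta> Re t, and \<delta> is chosen with \<delta> |Re t| < Im t.\<close>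

lemma rotate_upper:
  assumes "Im t > 0"
  obtains w :: complex where "Im w > 0" "Im (w * t) > 0"
proof -
  define \<delta> where "\<delta> = Im t / (1 + \<bar>Re t\<bar>)"
  have "\<delta> > 0" using assms by (simp add: \<delta>_def)
  moreover have "Im (Complex 1 \<delta> * t) > 0"
  proof -
    have "\<delta> * \<bar>Re t\<bar> < Im t" using assms by (simp add: \<delta>_def field_simps)
    moreover have "\<delta> * Re t \<ge> - (\<delta> * \<bar>Re t\<bar>)" using \<open>\<delta> > 0\<close>
      by (metis abs_ge_minus_self abs_mult abs_of_pos minus_le_iff)
    ultimately show ?thesis by simp
  qed
  ultimately show ?thesis using that[of "Complex 1 \<delta>"] by simp
qed

text \<open>A negative discriminant would make the form vanish at u + t v for some t in the upper
  half plane. Multiplying this vector by w only scales the form by w^2, and as \<open>u\<close> and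
  \<open>v\<close> are positive it brings all entries into the upper half plane, a
  contradiction.\<close>

lemma stable_quadratic_form:
  fixes Q :: "nat \<Rightarrow> nat \<Rightarrow> real"
  assumes sym: "\<And>k l. Q k l = Q l k"
    and nz: "\<And>z. (\<And>l. l < n \<Longrightarrow> Im (z l) > 0) \<Longrightarrow> (\<Sum>k<n. \<Sum>l<n. z k * z l * of_real (Q k l)) \<noteq> 0"
    and pos: "\<And>l. l < n \<Longrightarrow> u l > 0" "\<And>l. l < n \<Longrightarrow> v l > 0"
  shows "(\<Sum>k<n. \<Sum>l<n. u k * u l * Q k l) * (\<Sum>k<n. \<Sum>l<n. v k * v l * Q k l) \<le>
    (\<Sum>k<n. \<Sum>l<n. u k * v l * Q k l)\<^sup>2" (is "?a * ?c \<le> ?b\<^sup>2")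
proof (rule ccontr)
  assume "\<not> ?thesis"
  then have "?b\<^sup>2 < ?a * ?c" by (simp only: not_le)
  then obtain t :: complex where t: "Im t > 0" "of_real ?a + 2 * of_real ?b * t + of_real ?c * t\<^sup>2 = 0"
    by (rule quadratic_upper_root)
  obtain w where w: "Im w > 0" "Im (w * t) > 0" using rotate_upper[OF t(1)] .
  define z where "z l = w * (of_real (u l) + t * of_real (v l))" for l
  have b': "(\<Sum>k<n. \<Sum>l<n. v k * u l * Q k l) = ?b"
    by (subst sum.swap) (simp add: sym mult_ac)
  have "z k * z l * of_real (Q k l) = w\<^sup>2 * (of_real (u k * u l * Q k l) +
     t * of_real (u k * v l * Q k l) + t * of_real (v k * u l * Q k l) + t\<^sup>2 * of_real (v k * v l * Q k l))" for k l
    by (simp add: z_def algebra_simps power2_eq_square)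
  then have "(\<Sum>k<n. \<Sum>l<n. z k * z l * of_real (Q k l)) = w\<^sup>2 * (of_real ?a +
     t * of_real ?b + t * of_real (\<Sum>k<n. \<Sum>l<n. v k * u l * Q k l) + t\<^sup>2 * of_real ?c)"
    by (simp only: sum.distrib sum_distrib_left[symmetric] of_real_sum)
  also have "\<dots> = w\<^sup>2 * (of_real ?a + 2 * of_real ?b * t + of_real ?c * t\<^sup>2)"
    unfolding b' by (simp add: algebra_simps)
  finally have "(\<Sum>k<n. \<Sum>l<n. z k * z l * of_real (Q k l)) = 0" using t by simp
  moreover have "Im (z l) > 0" if "l < n" for l
  proof -
    have "Im (z l) = Im w * u l + Im (w * t) * v l" by (simp add: z_def algebra_simps)
    then show ?thesis using w pos[OF that] by (simp add: add_pos_pos)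
  qed
  ultimately show False using nz by blast
qed

text \<open>Up to the factor 2, the derivative of order \<open>\<gamma>\<close> is the quadratic
  form with matrix \<open>Q\<close>, and the unit vectors e_i and e_j pick out the three entries of
  the inequality.\<close>

lemma stable_imp_log_concave:
  fixes T :: "(nat \<Rightarrow> nat) \<Rightarrow> real"
  assumes pos: "\<And>\<alpha>. (\<Sum>l<n. \<alpha> l) = d \<Longrightarrow> T \<alpha> > 0"
    and cong: "\<And>\<alpha> \<beta>. (\<And>l. l < n \<Longrightarrow> \<alpha> l = \<beta> l) \<Longrightarrow> T \<alpha> = T \<beta>"
    and stable: "\<And>z. (\<And>l. l < n \<Longrightarrow> Im (z l) > 0) \<Longrightarrow>
      weighted_sum n (\<lambda>\<alpha>. of_real (T \<alpha>)) d (\<lambda>_. 0) z \<noteq> 0"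
  shows "log_concave_on d n T"
  unfolding log_concave_on_def
proof (intro allI impI)
  fix \<gamma>0 :: "nat \<Rightarrow> nat" and i j
  assume ij: "i < n" "j < n" "i \<noteq> j" and "(\<Sum>l<n. \<gamma>0 l) + 2 = d"
  \<comment> \<open>\<open>weighted_sum_stable\<close> asks for a multi-index that vanishes from
    \<open>n\<close> on; \<open>cong\<close> undoes the truncation at the end.\<close>
  define \<gamma> where "\<gamma> l = (if l < n then \<gamma>0 l else 0)" for l
  have s: "(\<Sum>l<n. \<gamma> l) + 2 = d" using \<open>_ = d\<close> by (simp add: \<gamma>_def)
  define Q where "Q k l = T ((\<gamma>(k := Suc (\<gamma> k)))(l := Suc ((\<gamma>(k := Suc (\<gamma> k))) l)))" for k l
  have sym: "Q k l = Q l k" for k l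
    unfolding Q_def by (rule arg_cong[where f = T]) (auto simp: fun_eq_iff)
  have nz: "(\<Sum>k<n. \<Sum>l<n. z k * z l * of_real (Q k l)) \<noteq> 0" if "\<And>l. l < n \<Longrightarrow> Im (z l) > 0" for z
  proof -
    have "weighted_sum n (\<lambda>\<alpha>. of_real (T \<alpha>)) 2 \<gamma> z \<noteq> 0"
    proof (rule weighted_sum_stable)
      show "of_real (T \<alpha>) \<noteq> (0 :: complex)" if "(\<Sum>l<n. \<alpha> l) = d" for \<alpha> using pos[OF that] by simp
      show "l \<ge> n \<Longrightarrow> \<gamma> l = 0" for l by (simp add: \<gamma>_def)
    qed (use stable s that in auto)
    also have "weighted_sum n (\<lambda>\<alpha>. of_real (T \<alpha>)) 2 \<gamma> z = (\<Sum>k<n. \<Sum>l<n. z k * z l * of_real (Q k l))"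
      by (simp add: numeral_2_eq_2 Q_def sum_distrib_left mult_ac)
    finally show ?thesis .
  qed
  define B where "B x y = (\<Sum>k<n. \<Sum>l<n. x k * y l * Q k l)" for x y :: "nat \<Rightarrow> real"
  \<comment> \<open>Unit vectors have zero entries while \<open>stable_quadratic_form\<close> asks
    for positive ones, so they are approached by \<open>e m \<eta>\<close> with \<eta> tending to 0
    from above.\<close>
  define e where "e m \<eta> l = (if l = m then 1 else 0) + \<eta>" for m :: nat and \<eta> :: real and l :: nat
  have B: "B (e i \<eta>) (e i \<eta>) * B (e j \<eta>) (e j \<eta>) \<le> (B (e i \<eta>) (e j \<eta>))\<^sup>2" if "\<eta> > 0" for \<eta>
    unfolding B_def by (rule stable_quadratic_form[OF sym nz]) (use that in \<open>auto simp: e_def\<close>)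
  have t0: "((\<lambda>\<eta>. B (e k \<eta>) (e l \<eta>)) \<longlongrightarrow> B (e k 0) (e l 0)) (at_right 0)" for k l
  proof -
    have "((\<lambda>\<eta>. e k \<eta> m) \<longlongrightarrow> e k 0 m) (at_right 0)" for k m
      unfolding e_def by (intro tendsto_intros)
    then show ?thesis unfolding B_def by (intro tendsto_intros)
  qed
  have "B (e i 0) (e i 0) * B (e j 0) (e j 0) \<le> (B (e i 0) (e j 0))\<^sup>2"
    by (rule tendsto_le[OF _ tendsto_power[OF t0] tendsto_mult[OF t0 t0]])
       (simp, rule eventually_mono[OF eventually_at_right_less B])
  moreover have "B (e k 0) (e l 0) = Q k l" if "k < n" "l < n" for k l
  proof -
    have "(\<Sum>m<n. (if m = k then 1 else 0) * f m) = f k" if "k < n" for f :: "nat \<Rightarrow> real" and k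
      using that by (simp add: sum.remove[of "{..<n}" k])
    then show ?thesis
      using that by (simp only: B_def e_def add_0_right mult.assoc sum_distrib_left[symmetric])
  qed
  ultimately have "Q i i * Q j j \<le> (Q i j)\<^sup>2" using ij by simp
  moreover have "Q i i = T (\<gamma>0(i := \<gamma>0 i + 2))" "Q j j = T (\<gamma>0(j := \<gamma>0 j + 2))"
    "Q i j = T (\<gamma>0(i := \<gamma>0 i + 1, j := \<gamma>0 j + 1))"
    unfolding Q_def using ij by (auto intro!: cong simp: \<gamma>_def)
  ultimately show "T (\<gamma>0(i := \<gamma>0 i + 2)) * T (\<gamma>0(j := \<gamma>0 j + 2)) \<le> (T (\<gamma>0(i := \<gamma>0 i + 1, j := \<gamma>0 j + 1)))\<^sup>2"
    by simp
qed

section \<open>Principal minors of positive definite matrices\<close>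

text \<open>The Leibniz formula for det(A[S]) with permutations of S itself, so that rows and
  columns need no renumbering as in \<open>submatrix\<close>.\<close>

definition principal_minor :: "(nat \<Rightarrow> nat \<Rightarrow> complex) \<Rightarrow> nat set \<Rightarrow> complex" where
  "principal_minor a S = (\<Sum>p | p permutes S. of_int (sign p) * (\<Prod>j\<in>S. a j (p j)))"

text \<open>\<open>pick S\<close> enumerates S in increasing order; transporting permutations along
  this bijection keeps their signs and products.\<close>

lemma det_submatrix_principal_minor:
  assumes "A \<in> carrier_mat d d" "S \<subseteq> {..<d}"
  shows "det (submatrix A S S) = principal_minor (\<lambda>i j. A $$ (i, j)) S"
proof -
  let ?k = "card S" and ?N = "{0..<card S}" and ?f = "pick S"
  have fin: "finite S" using assms(2) finite_subset by blast
  have "{i. i < d \<and> i \<in> S} = S" using assms(2) by auto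
  then have M: "submatrix A S S = mat ?k ?k (\<lambda>(i, j). A $$ (?f i, ?f j))"
    using assms(1) by (auto simp only: submatrix_def carrier_mat_def mem_Collect_eq)
  then have C: "submatrix A S S \<in> carrier_mat ?k ?k" and
    E: "\<And>i j. i < ?k \<Longrightarrow> j < ?k \<Longrightarrow> submatrix A S S $$ (i, j) = A $$ (?f i, ?f j)"
    by simp_all
  have inj: "inj_on ?f ?N"
    by (rule linorder_inj_onI) (auto dest: pick_mono_le[rotated])
  moreover have "?f ` ?N \<subseteq> S" by (auto intro: pick_in_set_le)
  ultimately have bij: "bij_betw ?f ?N S"
    using fin by (simp add: bij_betw_def card_image card_subset_eq)
  have bij': "bij_betw (inv_into ?N ?f) S ?N" using bij by (rule bij_betw_inv_into)
  have "(\<Sum>p | p permutes ?N. of_int (sign p) * (\<Prod>i\<in>?N. submatrix A S S $$ (i, p i))) =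
      principal_minor (\<lambda>i j. A $$ (i, j)) S"
    unfolding principal_minor_def
  proof (rule sum.reindex_bij_witness[of _ "map_permutation S (inv_into ?N ?f)" "map_permutation ?N ?f"])
    fix p assume p: "p \<in> {p. p permutes ?N}"
    show "map_permutation S (inv_into ?N ?f) (map_permutation ?N ?f p) = p"
      using p bij by (intro map_permutation_compose_inv) (auto simp: bij_betw_def)
    show "map_permutation ?N ?f p \<in> {p. p permutes S}"
      using p bij by (auto intro: map_permutation_permutes)
    have "(\<Prod>j\<in>S. A $$ (j, map_permutation ?N ?f p j)) = (\<Prod>i\<in>?N. A $$ (?f i, map_permutation ?N ?f p (?f i)))"
      using prod.reindex_bij_betw[OF bij] by (rule sym)
    also have "\<dots> = (\<Prod>i\<in>?N. submatrix A S S $$ (i, p i))"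
    proof (rule prod.cong[OF refl])
      fix i assume i: "i \<in> ?N"
      then have "p i \<in> ?N" using p by (simp only: mem_Collect_eq permutes_in_image)
      then show "A $$ (?f i, map_permutation ?N ?f p (?f i)) = submatrix A S S $$ (i, p i)"
        using i inj by (simp add: E map_permutation_apply)
    qed
    finally show "of_int (sign (map_permutation ?N ?f p)) * (\<Prod>j\<in>S. A $$ (j, map_permutation ?N ?f p j)) =
      of_int (sign p) * (\<Prod>i\<in>?N. submatrix A S S $$ (i, p i))"
      using p inj by (simp add: sign_map_permutation)
  next
    fix q assume q: "q \<in> {p. p permutes S}"
    show "map_permutation ?N ?f (map_permutation S (inv_into ?N ?f) q) = q"
      using q bij bij' by (intro map_permutation_compose_inv) (auto simp: bij_betw_def f_inv_into_f)
    show "map_permutation S (inv_into ?N ?f) q \<in> {p. p permutes ?N}"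
      using q bij' by (auto intro: map_permutation_permutes)
  qed
  then show ?thesis unfolding det_def'[OF C] by simp
qed

text \<open>The left side is det(diag(u) A + diag(y)) on V. Each row takes its entry from one of the
  two summands; if S is the set of rows that use the first, the other rows are forced to their own
  columns, which leaves a permutation of S.\<close>

lemma principal_minor_expand:
  assumes "finite V"
  shows "principal_minor (\<lambda>j k. u j * a j k + (if j = k then y j else 0)) V =
    (\<Sum>S\<in>Pow V. principal_minor a S * (\<Prod>j\<in>S. u j) * (\<Prod>j\<in>V - S. y j))"
proof -
  let ?t = "\<lambda>p S. of_int (sign p) * ((\<Prod>j\<in>S. u j * a j (p j)) * (\<Prod>j\<in>V - S. if j = p j then y j else 0))"
  have "principal_minor (\<lambda>j k. u j * a j k + (if j = k then y j else 0)) V =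
    (\<Sum>p | p permutes V. \<Sum>S\<in>Pow V. ?t p S)"
    unfolding principal_minor_def prod_add[OF assms] sum_distrib_left ..
  also have "\<dots> = (\<Sum>S\<in>Pow V. \<Sum>p | p permutes V. ?t p S)" by (rule sum.swap)
  also have "\<dots> = (\<Sum>S\<in>Pow V. principal_minor a S * (\<Prod>j\<in>S. u j) * (\<Prod>j\<in>V - S. y j))"
  proof (rule sum.cong[OF refl])
    fix S assume S: "S \<in> Pow V"
    then have finS: "finite S" using assms finite_subset by blast
    have "(\<Sum>p | p permutes V. ?t p S) = (\<Sum>p | p permutes S. ?t p S)"
    proof (rule sum.mono_neutral_right)
      show "finite {p. p permutes V}" using assms by (rule finite_permutations)
      show "{p. p permutes S} \<subseteq> {p. p permutes V}" using S by (auto intro: permutes_subset)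
      show "\<forall>p\<in>{p. p permutes V} - {p. p permutes S}. ?t p S = 0"
      proof
        fix p assume p: "p \<in> {p. p permutes V} - {p. p permutes S}"
        then obtain j where "j \<in> V - S" "p j \<noteq> j"
          using permutes_superset[of p V S] by auto
        then have "\<exists>j\<in>V - S. (if j = p j then y j else 0) = 0" by (intro bexI[of _ j]) auto
        then have "(\<Prod>j\<in>V - S. if j = p j then y j else 0) = 0"
          using assms by (intro prod_zero) blast+
        then show "?t p S = 0" by simp
      qed
    qed
    also have "\<dots> = (\<Sum>p | p permutes S. (of_int (sign p) * (\<Prod>j\<in>S. a j (p j))) * ((\<Prod>j\<in>S. u j) * (\<Prod>j\<in>V - S. y j)))"
    proof (rule sum.cong[OF refl])
      fix p assume "p \<in> {p. p permutes S}"
      then have "(\<Prod>j\<in>V - S. if j = p j then y j else 0) = (\<Prod>j\<in>V - S. y j)"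
        by (intro prod.cong) (auto simp: permutes_def)
      then show "?t p S = (of_int (sign p) * (\<Prod>j\<in>S. a j (p j))) * ((\<Prod>j\<in>S. u j) * (\<Prod>j\<in>V - S. y j))"
        by (simp add: prod.distrib mult_ac)
    qed
    finally show "(\<Sum>p | p permutes V. ?t p S) = principal_minor a S * (\<Prod>j\<in>S. u j) * (\<Prod>j\<in>V - S. y j)"
      by (simp add: principal_minor_def sum_distrib_right mult.assoc)
  qed
  finally show ?thesis .
qed

lemma principal_minor_eq_0_kernel:
  assumes "principal_minor M {..<d} = 0"
  obtains v j where "j < d" "v j \<noteq> 0" "\<And>i. i < d \<Longrightarrow> (\<Sum>k<d. M i k * v k) = 0"
proof -
  let ?M = "mat d d (\<lambda>(i, j). M i j)"
  have C: "?M \<in> carrier_mat d d" by simp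
  have "det ?M = principal_minor M {..<d}"
    unfolding det_def'[OF C] principal_minor_def atLeast0LessThan
  proof (intro sum.cong refl arg_cong2[where f = "(*)"] prod.cong)
    fix p i assume "p \<in> {p. p permutes {..<d}}" and i: "i \<in> {..<d}"
    then have "p i \<in> {..<d}" by (simp only: mem_Collect_eq permutes_in_image)
    then show "?M $$ (i, p i) = M i (p i)" using i by simp
  qed
  then obtain v where v: "v \<in> carrier_vec d" "v \<noteq> 0\<^sub>v d" "?M *\<^sub>v v = 0\<^sub>v d"
    using assms det_0_iff_vec_prod_zero[OF C] by auto
  obtain j where "j < d" "v $ j \<noteq> 0" using v(1,2) by (metis eq_vecI carrier_vecD index_zero_vec)
  moreover have "(\<Sum>k<d. M i k * v $ k) = 0" if "i < d" for i
  proof -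
    have "(?M *\<^sub>v v) $ i = (\<Sum>k<d. M i k * v $ k)"
      using that v(1) by (simp add: scalar_prod_def atLeast0LessThan)
    then show ?thesis using v(3) that by simp
  qed
  ultimately show ?thesis using that by blast
qed

section \<open>Nonvanishing determinants of diag(y) + z A\<close>

definition pos_def :: "nat \<Rightarrow> (nat \<Rightarrow> nat \<Rightarrow> complex) \<Rightarrow> bool" where
  "pos_def d a \<longleftrightarrow> (\<forall>i<d. \<forall>j<d. a j i = cnj (a i j)) \<and>
    (\<forall>v. (\<exists>j<d. v j \<noteq> 0) \<longrightarrow> 0 < (\<Sum>j<d. \<Sum>k<d. cnj (v j) * a j k * v k))"

text \<open>For a kernel vector \<open>v\<close>, multiplying row j by the conjugate of
  \<open>v j\<close> and adding up expresses z times \<open>?Q\<close> as minus a sum of terms y_j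
  |v_j|^2: the left side has positive imaginary part, the right side does not. An index with
  \<open>u j = 0\<close> has a row of the identity, which forces \<open>v j = 0\<close>; it is
  thereby deleted from the matrix.\<close>

lemma pos_def_stable:
  assumes "pos_def d a" "Im z > 0" "\<And>j. j < d \<Longrightarrow> u j = 1 \<and> Im (y j) \<ge> 0 \<or> u j = 0 \<and> y j = 1"
  shows "principal_minor (\<lambda>j k. (z * u j) * a j k + (if j = k then y j else 0)) {..<d} \<noteq> 0"
proof
  assume "principal_minor (\<lambda>j k. (z * u j) * a j k + (if j = k then y j else 0)) {..<d} = 0"
  then obtain v l where l: "l < d" "v l \<noteq> 0" and
    v: "\<And>j. j < d \<Longrightarrow> (\<Sum>k<d. ((z * u j) * a j k + (if j = k then y j else 0)) * v k) = 0"
    by (rule principal_minor_eq_0_kernel) (rule that)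
  have row: "z * u j * (\<Sum>k<d. a j k * v k) + y j * v j = 0" if "j < d" for j
  proof -
    have "(\<Sum>k<d. ((z * u j) * a j k + (if j = k then y j else 0)) * v k) =
      z * u j * (\<Sum>k<d. a j k * v k) + (\<Sum>k<d. (if j = k then y j else 0) * v k)"
      by (simp add: ring_distribs sum.distrib sum_distrib_left mult_ac)
    also have "(\<Sum>k<d. (if j = k then y j else 0) * v k) = y j * v j"
      using that by (simp add: if_distrib[of "\<lambda>x. x * _"] cong: if_cong)
    finally show ?thesis using v[OF that] by simp
  qed
  let ?Q = "\<Sum>j<d. \<Sum>k<d. cnj (v j) * a j k * v k"
  have im: "\<exists>r\<ge>0. Im (z * (cnj (v j) * (\<Sum>k<d. a j k * v k))) = - r" if j: "j < d" for j
  proof (cases "u j = 0")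
    case True
    then have "v j = 0" using row[OF j] assms(3)[OF j] by auto
    then show ?thesis by auto
  next
    case False
    then have u: "u j = 1" "Im (y j) \<ge> 0" using assms(3)[OF j] by auto
    have "z * (\<Sum>k<d. a j k * v k) = - (y j * v j)" using row[OF j] u by (simp add: add_eq_0_iff)
    then have "z * (cnj (v j) * (\<Sum>k<d. a j k * v k)) = - (y j * (v j * cnj (v j)))"
      by (metis mult.assoc mult.commute mult_minus_left)
    also have "\<dots> = - (y j * of_real ((cmod (v j))\<^sup>2))" by (simp only: complex_norm_square)
    finally have "Im (z * (cnj (v j) * (\<Sum>k<d. a j k * v k))) = - (Im (y j) * (cmod (v j))\<^sup>2)" by simp
    then show ?thesis using u by (intro exI[of _ "Im (y j) * (cmod (v j))\<^sup>2"]) simp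
  qed
  have "z * ?Q = (\<Sum>j<d. z * (cnj (v j) * (\<Sum>k<d. a j k * v k)))"
    by (simp add: sum_distrib_left mult_ac)
  then have "Im (z * ?Q) = (\<Sum>j<d. Im (z * (cnj (v j) * (\<Sum>k<d. a j k * v k))))" by (simp only: Im_sum)
  also have "\<dots> \<le> 0"
  proof (rule sum_nonpos)
    fix j assume "j \<in> {..<d}"
    then show "Im (z * (cnj (v j) * (\<Sum>k<d. a j k * v k))) \<le> 0" using im[of j] by auto
  qed
  finally have "Im (z * ?Q) \<le> 0" .
  moreover have "0 < ?Q"
    using assms(1)[unfolded pos_def_def, THEN conjunct2, rule_format, of v] l by blast
  then have "Re ?Q > 0" "Im ?Q = 0" by (simp_all only: less_complex_def zero_complex.sel)
  ultimately show False using assms(2) by (simp add: mult_le_0_iff)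
qed

section \<open>Extraction of coefficients, one index at a time\<close>

text \<open>The product \<open>\<Prod>\<^sub>i \<Sum>\<^sub>S z\<^sub>i\<^bsup>|S|\<^esup> det (A[S])\<close> expanded, where a tuple \<open>(S\<^sub>i)\<close> in which the index \<open>j\<close> occurs
  \<open>c\<^sub>j\<close> times gets the weight \<open>\<Prod>\<^sub>j w j c\<^sub>j\<close>.  The weight \<open>x\<^sup>n\<^sup>-\<^sup>c\<close> evaluates at \<open>x\<^sub>j = x\<close>; the weights
  \<open>of_bool (c = 0)\<close> and \<open>of_bool (c = 1)\<close> extract the coefficients of \<open>x\<^sub>j\<^sup>n\<close> and \<open>x\<^sub>j\<^sup>n\<^sup>-\<^sup>1\<close>.\<close>

definition slot_sum :: "nat \<Rightarrow> (nat \<Rightarrow> nat \<Rightarrow> complex) \<Rightarrow> nat set \<Rightarrow> (nat \<Rightarrow> complex) \<Rightarrow> (nat \<Rightarrow> nat \<Rightarrow> complex) \<Rightarrow> complex" where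
  "slot_sum n a V z w = (\<Sum>S\<in>{..<n} \<rightarrow>\<^sub>E Pow V.
     (\<Prod>i<n. z i ^ card (S i) * principal_minor a (S i)) * (\<Prod>j\<in>V. w j (card {i\<in>{..<n}. j \<in> S i})))"

text \<open>The product is regrouped by indices j instead of slots i: j receives \<open>u j\<close>
  from each of the c slots that contain it and \<open>y j\<close> from the other n - c.\<close>

lemma slot_sum_product:
  assumes "finite V"
  shows "slot_sum n a V z (\<lambda>j c. u j ^ c * y j ^ (n - c)) =
    (\<Prod>i<n. principal_minor (\<lambda>j k. (z i * u j) * a j k + (if j = k then y j else 0)) V)"
proof -
  have "(\<Prod>i<n. principal_minor (\<lambda>j k. (z i * u j) * a j k + (if j = k then y j else 0)) V) =
    (\<Sum>S\<in>{..<n} \<rightarrow>\<^sub>E Pow V. \<Prod>i<n. principal_minor a (S i) * (\<Prod>j\<in>S i. z i * u j) * (\<Prod>j\<in>V - S i. y j))"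
    unfolding principal_minor_expand[OF assms] using assms by (intro prod_sum_PiE) auto
  also have "\<dots> = slot_sum n a V z (\<lambda>j c. u j ^ c * y j ^ (n - c))"
    unfolding slot_sum_def
  proof (rule sum.cong[OF refl])
    fix S assume S: "S \<in> {..<n} \<rightarrow>\<^sub>E Pow V"
    have "(\<Prod>j\<in>S i. u j) * (\<Prod>j\<in>V - S i. y j) = (\<Prod>j\<in>V. if j \<in> S i then u j else y j)" if "i < n" for i
    proof -
      have "S i \<subseteq> V" using S that by auto
      then show ?thesis using assms
        by (simp add: prod.If_cases Int_absorb1 Diff_eq[symmetric])
    qed
    then have "(\<Prod>i<n. principal_minor a (S i) * (\<Prod>j\<in>S i. z i * u j) * (\<Prod>j\<in>V - S i. y j)) =
      (\<Prod>i<n. (z i ^ card (S i) * principal_minor a (S i)) * (\<Prod>j\<in>V. if j \<in> S i then u j else y j))"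
      by (intro prod.cong) (auto simp: prod.distrib mult_ac)
    also have "\<dots> = (\<Prod>i<n. z i ^ card (S i) * principal_minor a (S i)) *
        (\<Prod>j\<in>V. \<Prod>i<n. if j \<in> S i then u j else y j)"
      by (simp only: prod.distrib prod.swap[of _ V "{..<n}"])
    also have "(\<Prod>j\<in>V. \<Prod>i<n. if j \<in> S i then u j else y j) =
        (\<Prod>j\<in>V. u j ^ card {i\<in>{..<n}. j \<in> S i} * y j ^ (n - card {i\<in>{..<n}. j \<in> S i}))"
    proof (rule prod.cong[OF refl])
      fix j
      have "card ({..<n} \<inter> - {i. j \<in> S i}) = n - card {i\<in>{..<n}. j \<in> S i}"
        by (subst card_lessThan[symmetric], subst card_Diff_subset[symmetric])
          (auto intro: arg_cong[where f = card])
      then show "(\<Prod>i<n. if j \<in> S i then u j else y j) =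
          u j ^ card {i\<in>{..<n}. j \<in> S i} * y j ^ (n - card {i\<in>{..<n}. j \<in> S i})"
        by (simp add: prod.If_cases Int_def)
    qed
    finally show "(\<Prod>i<n. principal_minor a (S i) * (\<Prod>j\<in>S i. z i * u j) * (\<Prod>j\<in>V - S i. y j)) =
      (\<Prod>i<n. z i ^ card (S i) * principal_minor a (S i)) *
        (\<Prod>j\<in>V. u j ^ card {i\<in>{..<n}. j \<in> S i} * y j ^ (n - card {i\<in>{..<n}. j \<in> S i}))" .
  qed
  finally show ?thesis ..
qed

text \<open>Each tuple carries exactly one factor from the weight at \<open>j\<close>, evaluated at
  a count of at most \<open>n\<close>. This turns the slot sum into a polynomial in x_j.\<close>

lemma slot_sum_linear:
  assumes "finite V" "j \<in> V" and f: "\<And>c. c \<le> n \<Longrightarrow> f c = (\<Sum>m\<le>n. b m * g m c)"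
  shows "slot_sum n a V z (w(j := f)) = (\<Sum>m\<le>n. b m * slot_sum n a V z (w(j := g m)))"
proof -
  have "(\<Prod>k\<in>V. (w(j := f)) k (card {i\<in>{..<n}. k \<in> S i})) =
     (\<Sum>m\<le>n. b m * (\<Prod>k\<in>V. (w(j := g m)) k (card {i\<in>{..<n}. k \<in> S i})))" for S :: "nat \<Rightarrow> nat set"
  proof -
    have "card {i\<in>{..<n}. j \<in> S i} \<le> card {..<n}" by (rule card_mono) auto
    then have "f (card {i\<in>{..<n}. j \<in> S i}) = (\<Sum>m\<le>n. b m * g m (card {i\<in>{..<n}. j \<in> S i}))" by (simp add: f)
    moreover have "(\<Prod>k\<in>V. (w(j := h)) k (card {i\<in>{..<n}. k \<in> S i})) =
      h (card {i\<in>{..<n}. j \<in> S i}) * (\<Prod>k\<in>V - {j}. w k (card {i\<in>{..<n}. k \<in> S i}))" for h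
      using assms(1,2) by (simp add: prod.remove[of V j])
    ultimately show ?thesis by (simp only: sum_distrib_right mult.assoc)
  qed
  then show ?thesis
    unfolding slot_sum_def by (simp only: sum_distrib_left, subst sum.swap) (simp add: mult_ac)
qed

text \<open>The index \<open>j\<close> is evaluated at \<open>y j\<close> if \<open>u j = 1\<close>, and at infinity if \<open>u j = 0\<close>.\<close>

lemma slot_sum_nonzero:
  assumes "pos_def d a" "n \<ge> 1" "\<And>i. i < n \<Longrightarrow> Im (z i) > 0" "finite L" "L \<subseteq> {..<d}"
    and "\<And>j. j < d \<Longrightarrow> u j = 1 \<and> Im (y j) \<ge> 0 \<or> u j = 0 \<and> y j = 1"
  shows "slot_sum n a {..<d} z (\<lambda>j. if j \<in> L then (\<lambda>c. of_bool (c = 1)) else (\<lambda>c. u j ^ c * y j ^ (n - c))) \<noteq> 0"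
  using assms(4-6)
proof (induction L arbitrary: u y)
  case empty
  then show ?case using assms(1,3) by (auto simp: slot_sum_product pos_def_stable)
next
  case (insert j L)
  let ?w = "\<lambda>L u y j. if j \<in> L then (\<lambda>c. of_bool (c = 1)) else (\<lambda>c. u j ^ c * y j ^ (n - c))"
  let ?G = "slot_sum n a {..<d} z"
  define w where "w = ?w L u y"
  define g where "g m = ?G (w(j := (\<lambda>c. of_bool (c = m))))" for m
  have j: "j \<in> {..<d}" using insert by simp
  have upd: "?w L (u(j := s)) (y(j := x)) = w(j := (\<lambda>c. s ^ c * x ^ (n - c)))" for s x
    using insert.hyps by (auto simp: w_def fun_eq_iff)
  \<comment> \<open>The coefficient of x_j^n is the value at infinity, \<open>u j = 0\<close> and
    \<open>y j = 1\<close>, where the weight 0^c 1^(n-c) is 1 for c = 0 and 0 otherwise. So the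
    induction hypothesis covers it.\<close>
  have g0: "g 0 \<noteq> 0"
  proof -
    have "?G (?w L (u(j := 0)) (y(j := 1))) \<noteq> 0"
      by (rule insert.IH) (use insert.prems in auto)
    also have "(\<lambda>c. 0 ^ c * 1 ^ (n - c)) = (\<lambda>c :: nat. of_bool (c = 0) :: complex)"
      by (auto simp: fun_eq_iff)
    then have "?w L (u(j := 0)) (y(j := 1)) = w(j := (\<lambda>c. of_bool (c = 0)))" unfolding upd by simp
    finally show ?thesis unfolding g_def .
  qed
  \<comment> \<open>\<open>p\<close> is the slot sum as a polynomial in x_j; \<open>g m\<close>
    collects the tuples in which j occurs m times.\<close>
  define p where "p = (\<Sum>m\<le>n. monom (g m) (n - m))"
  have coeff: "coeff p (n - m) = g m" if "m \<le> n" for m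
  proof -
    have "coeff p (n - m) = (\<Sum>k\<le>n. if k = m then g k else 0)"
      unfolding p_def coeff_sum using that by (intro sum.cong) auto
    then show ?thesis using that by simp
  qed
  have "degree p \<le> n" unfolding p_def
    by (intro degree_sum_le) (auto intro: order.trans[OF degree_monom_le])
  then have deg: "degree p = n" using coeff[of 0] g0 by (intro antisym le_degree) auto
  obtain n' where n: "n = Suc n'" using assms(2) by (cases n) auto
  have roots: "Im r < 0" if "poly p r = 0" for r
  proof (rule ccontr)
    assume "\<not> Im r < 0"
    then have "?G (?w L (u(j := 1)) (y(j := r))) \<noteq> 0"
      by (intro insert.IH) (use insert.prems in auto)
    also have "?G (?w L (u(j := 1)) (y(j := r))) = (\<Sum>m\<le>n. r ^ (n - m) * g m)"
      unfolding upd g_def by (rule slot_sum_linear) (use j in \<open>auto simp: if_distrib cong: if_cong\<close>)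
    also have "\<dots> = poly p r" by (simp add: p_def poly_sum poly_monom mult_ac)
    finally show False using that by simp
  qed
  \<comment> \<open>With no root in the closed upper half plane, \<open>p\<close> has a nonzero
    coefficient in degree n - 1, and this is \<open>g 1\<close>.\<close>
  have "Im (coeff p n' / coeff p (Suc n')) > 0"
    by (rule Im_coeff_ratio_pos) (use deg n roots in auto)
  moreover have "coeff p n' = g 1" using coeff[of 1] n by simp
  ultimately have "g 1 \<noteq> 0" by auto
  moreover have "?w (insert j L) u y = w(j := (\<lambda>c. of_bool (c = 1)))"
    by (auto simp: w_def fun_eq_iff)
  ultimately show ?case unfolding g_def by simp
qed

section \<open>Positivity of principal minors\<close>

text \<open>Conjugating a Hermitian matrix transposes it, which replaces each permutation by its
  inverse, of the same sign.\<close>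

lemma principal_minor_real:
  assumes "finite S" and herm: "\<And>i j. i \<in> S \<Longrightarrow> j \<in> S \<Longrightarrow> a j i = cnj (a i j)"
  shows "Im (principal_minor a S) = 0"
proof -
  have "cnj (principal_minor a S) = principal_minor a S"
    unfolding principal_minor_def cnj_sum
  proof (rule sum.reindex_bij_witness[of _ "inv_into UNIV" "inv_into UNIV"])
    fix p assume p: "p \<in> {p. p permutes S}"
    show "inv_into UNIV (inv_into UNIV p) = p" using p by (auto simp: permutes_inv_inv)
    show "inv_into UNIV p \<in> {p. p permutes S}" using p by (auto simp: permutes_inv)
    have "(\<Prod>j\<in>S. a j (inv_into UNIV p j)) = (\<Prod>j\<in>S. a (p j) (inv_into UNIV p (p j)))"
      using p prod.permute[of p S "\<lambda>j. a j (inv_into UNIV p j)"] by (simp add: o_def)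
    also have "\<dots> = (\<Prod>j\<in>S. cnj (a j (p j)))"
    proof (rule prod.cong[OF refl])
      fix j assume j: "j \<in> S"
      then have "p j \<in> S" using p by (simp only: mem_Collect_eq permutes_in_image)
      then show "a (p j) (inv_into UNIV p (p j)) = cnj (a j (p j))"
        using herm[OF j] p by (simp add: permutes_inverses(2)[of p S])
    qed
    finally show "of_int (sign (inv_into UNIV p)) * (\<Prod>j\<in>S. a j (inv_into UNIV p j)) = cnj (of_int (sign p) * (\<Prod>j\<in>S. a j (p j)))"
      using p sign_inverse[of p] assms(1) by (auto simp: permutation_permutes)
  next
    fix p assume p: "p \<in> {p. p permutes S}"
    show "inv_into UNIV (inv_into UNIV p) = p" using p by (auto simp: permutes_inv_inv)
    show "inv_into UNIV p \<in> {p. p permutes S}" using p by (auto simp: permutes_inv)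
  qed
  then show ?thesis by (simp add: complex_eq_iff)
qed

lemma principal_minor_empty: "principal_minor a {} = 1"
  by (simp add: principal_minor_def)

text \<open>The minor is 1 at the identity matrix; by the intermediate value theorem it cannot
  become negative on the way to A without a zero, which \<open>pos_def_stable\<close>
  excludes.\<close>

lemma pos_def_principal_minor_pos:
  assumes a: "pos_def d a" and S: "S \<subseteq> {..<d}"
  shows "0 < principal_minor a S"
proof -
  have finS: "finite S" using S finite_subset by blast
  have herm: "a j i = cnj (a i j)" if "i < d" "j < d" for i j using a that unfolding pos_def_def by blast
  have real: "Im (principal_minor a T) = 0" if "T \<subseteq> S" for T
    by (rule principal_minor_real[OF finite_subset[OF that finS] herm]) (use S that in auto)
  \<comment> \<open>\<open>f s\<close> is the minor of \<open>(1 - s) I + s A\<close> on \<open>S\<close>; it is real and nonzero along the path from \<open>I\<close> to \<open>A\<close>.\<close>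
  define f :: "real \<Rightarrow> complex" where
    "f s = (\<Sum>T\<in>Pow S. principal_minor a T * of_real s ^ card T * of_real (1 - s) ^ card (S - T))" for s
  have im: "Im (f s) = 0" for s
  proof -
    have "Im (principal_minor a T * of_real s ^ card T * of_real (1 - s) ^ card (S - T)) = 0" if "T \<subseteq> S" for T
    proof -
      have "principal_minor a T * of_real s ^ card T * of_real (1 - s) ^ card (S - T) =
          principal_minor a T * of_real (s ^ card T * (1 - s) ^ card (S - T))"
        by (simp only: of_real_mult of_real_power mult.assoc)
      then show ?thesis using real[OF that] by simp
    qed
    then show ?thesis unfolding f_def Im_sum by (intro sum.neutral) auto
  qed
  have nz: "f s \<noteq> 0" if s: "0 < s" "s \<le> 1" for s
  proof -
    \<comment> \<open>The matrix is multiplied by i to fit \<open>pos_def_stable\<close>: z = i s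
      and y = i (1 - s) on S, while \<open>u\<close> = 0 and \<open>y\<close> = 1 elsewhere cut out
      S. The factor i^|S| then splits off.\<close>
    define u where "u j = (if j \<in> S then 1 else 0 :: complex)" for j
    define y where "y j = (if j \<in> S then \<i> * of_real (1 - s) else 1)" for j
    have "0 \<noteq> principal_minor (\<lambda>j k. (\<i> * of_real s * u j) * a j k + (if j = k then y j else 0)) {..<d}"
      by (rule pos_def_stable[OF a, symmetric]) (use s in \<open>auto simp: u_def y_def\<close>)
    also have "principal_minor (\<lambda>j k. (\<i> * of_real s * u j) * a j k + (if j = k then y j else 0)) {..<d} =
        (\<Sum>T\<in>Pow {..<d}. principal_minor a T * (\<Prod>j\<in>T. \<i> * of_real s * u j) * (\<Prod>j\<in>{..<d} - T. y j))"
      by (rule principal_minor_expand) simp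
    also have "\<dots> = (\<Sum>T\<in>Pow S. principal_minor a T * (\<Prod>j\<in>T. \<i> * of_real s * u j) * (\<Prod>j\<in>{..<d} - T. y j))"
    proof (rule sum.mono_neutral_right)
      show "\<forall>T\<in>Pow {..<d} - Pow S. principal_minor a T * (\<Prod>j\<in>T. \<i> * of_real s * u j) * (\<Prod>j\<in>{..<d} - T. y j) = 0"
      proof
        fix T assume T: "T \<in> Pow {..<d} - Pow S"
        then have "finite T" "\<exists>j\<in>T. \<i> * of_real s * u j = 0" using finite_subset by (auto simp: u_def)
        then have "(\<Prod>j\<in>T. \<i> * of_real s * u j) = 0" by (rule prod_zero)
        then show "principal_minor a T * (\<Prod>j\<in>T. \<i> * of_real s * u j) * (\<Prod>j\<in>{..<d} - T. y j) = 0"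
          by (simp only: mult_zero_left mult_zero_right)
      qed
    qed (use S in auto)
    also have "\<dots> = (\<Sum>T\<in>Pow S. \<i> ^ card S * (principal_minor a T * of_real s ^ card T * of_real (1 - s) ^ card (S - T)))"
    proof (rule sum.cong[OF refl])
      fix T assume T: "T \<in> Pow S"
      have "(\<Prod>j\<in>T. \<i> * of_real s * u j) = (\<Prod>j\<in>T. \<i> * of_real s)"
        using T by (intro prod.cong) (auto simp: u_def)
      then have u: "(\<Prod>j\<in>T. \<i> * of_real s * u j) = (\<i> * of_real s) ^ card T"
        by (simp only: prod_constant)
      have "(\<Prod>j\<in>{..<d} - T. y j) = (\<Prod>j\<in>S - T. \<i> * of_real (1 - s))"
        using T S by (intro prod.mono_neutral_cong_right) (auto simp: y_def)
      then have y: "(\<Prod>j\<in>{..<d} - T. y j) = (\<i> * of_real (1 - s)) ^ card (S - T)"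
        by (simp only: prod_constant)
      have c: "card S = card T + card (S - T)"
        using T finS by (metis Diff_partition PowD card_Un_disjoint Diff_disjoint finite_subset finite_Diff)
      show "principal_minor a T * (\<Prod>j\<in>T. \<i> * of_real s * u j) * (\<Prod>j\<in>{..<d} - T. y j) =
        \<i> ^ card S * (principal_minor a T * of_real s ^ card T * of_real (1 - s) ^ card (S - T))"
        unfolding u y c by (simp only: power_mult_distrib power_add mult_ac)
    qed
    also have "\<dots> = \<i> ^ card S * f s" by (simp add: f_def sum_distrib_left)
    finally show ?thesis by auto
  qed
  have card0: "card T = 0 \<longleftrightarrow> T = {}" if "T \<subseteq> S" for T
    using that finS finite_subset by (metis card_0_eq)
  have f0: "f 0 = 1"
  proof -
    have "f 0 = (\<Sum>T\<in>Pow S. if T = {} then 1 else 0)"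
      unfolding f_def using card0 by (intro sum.cong) (auto simp: principal_minor_empty power_0_left)
    then show ?thesis using finS by simp
  qed
  have f1: "f 1 = principal_minor a S"
  proof -
    have "f 1 = (\<Sum>T\<in>Pow S. if T = S then principal_minor a S else 0)"
      unfolding f_def
    proof (rule sum.cong[OF refl])
      fix T assume "T \<in> Pow S"
      then have "card (S - T) = 0 \<longleftrightarrow> T = S" using card0[of "S - T"] by auto
      then show "principal_minor a T * of_real 1 ^ card T * of_real (1 - 1) ^ card (S - T) =
          (if T = S then principal_minor a S else 0)" by (auto simp: power_0_left)
    qed
    then show ?thesis using finS by simp
  qed
  have "Re (f 1) > 0"
  proof (rule ccontr)
    assume "\<not> Re (f 1) > 0"
    moreover have "continuous_on {0..1} (\<lambda>s. Re (f s))" unfolding f_def by (intro continuous_intros)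
    ultimately obtain s where "0 \<le> s" "s \<le> 1" "Re (f s) = 0"
      using IVT2'[of "\<lambda>s. Re (f s)" 1 0 0] f0 by auto
    \<comment> \<open>\<open>nz\<close> leaves out s = 0, where z = i s would not lie in the upper
      half plane; there \<open>f0\<close> applies.\<close>
    then show False using nz[of s] im[of s] f0 by (cases "s = 0") (auto simp: complex_eq_iff)
  qed
  then show ?thesis using f1 real[of S] by (simp add: less_complex_def)
qed

section \<open>The generating function of the Fischer sums\<close>

text \<open>Zeros from \<open>n\<close> on give each exponent vector one representative and make the
  set finite.\<close>

definition compositions :: "nat \<Rightarrow> nat \<Rightarrow> (nat \<Rightarrow> nat) set" where
  "compositions n e = {\<mu>. (\<Sum>i<n. \<mu> i) = e \<and> (\<forall>i\<ge>n. \<mu> i = 0)}"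

lemma finite_compositions: "finite (compositions n e)"
proof (rule finite_subset)
  show "compositions n e \<subseteq> {\<mu>. \<forall>i. (i \<in> {..<n} \<longrightarrow> \<mu> i \<in> {..e}) \<and> (i \<notin> {..<n} \<longrightarrow> \<mu> i = 0)}"
    by (auto simp: compositions_def intro: member_le_sum)
qed (rule finite_set_of_finite_funs; simp)

text \<open>The multinomial coefficient e!/\<mu>! counts the words of length e in which each letter
  i occurs \<open>\<mu> i\<close> times.\<close>

lemma weighted_sum_eq:
  "weighted_sum n T e \<gamma> z =
    (\<Sum>\<mu>\<in>compositions n e. fact e / (\<Prod>i<n. fact (\<mu> i)) * (\<Prod>i<n. z i ^ \<mu> i) * T (\<lambda>i. \<gamma> i + \<mu> i))"
proof (induction e arbitrary: \<gamma>)
  case 0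
  have "compositions n 0 = {\<lambda>_. 0}"
    by (auto simp: compositions_def fun_eq_iff) (metis lessThan_iff not_le)
  then show ?case by simp
next
  case (Suc e)
  define h where "h \<nu> = fact e / (\<Prod>i<n. fact (\<nu> i)) * (\<Prod>i<n. z i ^ \<nu> i) * T (\<lambda>i. \<gamma> i + \<nu> i)" for \<nu>
  \<comment> \<open>Prefixing the letter \<open>l\<close> turns \<mu> into \<nu> = \<mu> + e_l, and
    1/\<mu>! is \<open>\<nu> l\<close> divided by \<nu>!. Summed over l, these factors give e + 1,
    which completes e! to (e + 1)!.\<close>
  have step: "z l * weighted_sum n T e (\<gamma>(l := Suc (\<gamma> l))) z = (\<Sum>\<nu>\<in>compositions n (Suc e). of_nat (\<nu> l) * h \<nu>)"
    if l: "l < n" for l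
  proof -
    let ?C = "{\<nu> \<in> compositions n (Suc e). \<nu> l > 0}"
    have up: "(\<Prod>i<n. g i ((\<mu>(l := Suc (\<mu> l))) i)) = g l (Suc (\<mu> l)) * (\<Prod>i\<in>{..<n} - {l}. g i (\<mu> i))"
      "(\<Prod>i<n. g i (\<mu> i)) = g l (\<mu> l) * (\<Prod>i\<in>{..<n} - {l}. g i (\<mu> i))"
      for g :: "nat \<Rightarrow> nat \<Rightarrow> complex" and \<mu>
      using l by (simp_all add: prod.remove[of "{..<n}" l])
    have "(\<Sum>\<nu>\<in>compositions n (Suc e). of_nat (\<nu> l) * h \<nu>) = (\<Sum>\<nu>\<in>?C. of_nat (\<nu> l) * h \<nu>)"
      by (rule sum.mono_neutral_right) (auto simp: finite_compositions)
    also have "\<dots> = (\<Sum>\<mu>\<in>compositions n e. z l * (fact e / (\<Prod>i<n. fact (\<mu> i)) * (\<Prod>i<n. z i ^ \<mu> i) *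
        T (\<lambda>i. (\<gamma>(l := Suc (\<gamma> l))) i + \<mu> i)))"
    proof (rule sum.reindex_bij_witness[of _ "\<lambda>\<mu>. \<mu>(l := Suc (\<mu> l))" "\<lambda>\<nu>. \<nu>(l := \<nu> l - 1)"])
      fix \<mu> assume \<mu>: "\<mu> \<in> compositions n e"
      show "\<mu>(l := Suc (\<mu> l)) \<in> ?C"
        using \<mu> l sum_fun_upd_add[OF l, of \<mu> 1] by (auto simp: compositions_def)
      show "(\<mu>(l := Suc (\<mu> l)))(l := (\<mu>(l := Suc (\<mu> l))) l - 1) = \<mu>" by simp
    next
      fix \<nu> assume \<nu>: "\<nu> \<in> ?C"
      define \<mu> where "\<mu> = \<nu>(l := \<nu> l - 1)"
      have \<nu>_eq: "\<nu> = \<mu>(l := Suc (\<mu> l))" using \<nu> by (auto simp: \<mu>_def)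
      then show "\<mu>(l := Suc (\<mu> l)) = \<nu>" by simp
      show "\<mu> \<in> compositions n e"
        using \<nu> l sum_fun_upd_add[OF l, of \<mu> 1] unfolding \<nu>_eq by (auto simp: compositions_def split: if_splits)
      have T: "(\<lambda>i. (\<gamma>(l := Suc (\<gamma> l))) i + \<mu> i) = (\<lambda>i. \<gamma> i + (\<mu>(l := Suc (\<mu> l))) i)"
        by (auto simp: fun_eq_iff)
      show "z l * (fact e / (\<Prod>i<n. fact (\<mu> i)) * (\<Prod>i<n. z i ^ \<mu> i) *
        T (\<lambda>i. (\<gamma>(l := Suc (\<gamma> l))) i + \<mu> i)) = of_nat (\<nu> l) * h \<nu>"
        unfolding \<nu>_eq h_def T up[of "\<lambda>_. fact"] up[of "\<lambda>i k. z i ^ k"]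
        by (simp add: field_simps del: of_nat_Suc)
    qed
    finally show ?thesis by (simp add: Suc.IH sum_distrib_left)
  qed
  have "weighted_sum n T (Suc e) \<gamma> z = (\<Sum>l<n. \<Sum>\<nu>\<in>compositions n (Suc e). of_nat (\<nu> l) * h \<nu>)"
    by (simp add: step)
  also have "\<dots> = (\<Sum>\<nu>\<in>compositions n (Suc e). (\<Sum>l<n. of_nat (\<nu> l)) * h \<nu>)"
    by (subst sum.swap) (simp add: sum_distrib_right)
  also have "\<dots> = (\<Sum>\<nu>\<in>compositions n (Suc e). of_nat (Suc e) * h \<nu>)"
    by (rule sum.cong) (auto simp: compositions_def simp flip: of_nat_sum)
  finally show ?case by (simp add: h_def field_simps)
qed

definition fischer_minors :: "nat \<Rightarrow> nat \<Rightarrow> (nat \<Rightarrow> nat \<Rightarrow> complex) \<Rightarrow> (nat \<Rightarrow> nat) \<Rightarrow> complex" where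
  "fischer_minors d n a \<alpha> = (\<Sum>S\<in>ordered_partitions d n \<alpha>. \<Prod>i<n. principal_minor a (S i))"

lemma finite_ordered_partitions: "finite (ordered_partitions d n \<alpha>)"
  by (rule finite_subset[of _ "{..<n} \<rightarrow>\<^sub>E Pow {..<d}"])
    (auto simp: ordered_partitions_def intro: finite_PiE)

text \<open>Consecutive intervals of lengths \<open>\<alpha> i\<close> form such a tuple. This makes
  the Fischer sums of a positive definite matrix strictly positive.\<close>

lemma ordered_partitions_nonempty:
  assumes "(\<Sum>i<n. \<alpha> i) = d"
  shows "ordered_partitions d n \<alpha> \<noteq> {}"
proof -
  define P where "P i = (\<Sum>l<i. \<alpha> l)" for i
  define S where "S = restrict (\<lambda>i. {P i..<P (Suc i)}) {..<n}"
  have mono: "i \<le> k \<Longrightarrow> P i \<le> P k" for i k unfolding P_def by (rule sum_mono2) auto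
  have Pn: "P n = d" using assms by (simp add: P_def)
  have "S \<in> {..<n} \<rightarrow>\<^sub>E Pow {..<d}"
    using mono Pn by (fastforce simp: S_def dest: Suc_leI)
  moreover have "disjoint_family_on S {..<n}"
  unfolding disjoint_family_on_def
  proof (intro ballI impI)
    fix i k assume "i \<in> {..<n}" "k \<in> {..<n}" "i \<noteq> k"
    then show "S i \<inter> S k = {}" using mono[of "Suc i" k] mono[of "Suc k" i]
      by (cases "i < k") (auto simp: S_def)
  qed
  moreover have "(\<Union>i<m. {P i..<P (Suc i)}) = {..<P m}" for m
  proof (induction m)
    case (Suc m)
    then show ?case using mono[of m "Suc m"] by (auto simp: lessThan_Suc)
  qed (simp add: P_def)
  then have "(\<Union>i<n. S i) = {..<d}" using Pn by (simp add: S_def)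
  moreover have "\<forall>i<n. card (S i) = \<alpha> i" by (simp add: S_def P_def)
  ultimately show ?thesis unfolding ordered_partitions_def by blast
qed

lemma fischer_minors_pos:
  assumes "pos_def d a" "(\<Sum>i<n. \<alpha> i) = d"
  shows "0 < fischer_minors d n a \<alpha>"
proof -
  have "(\<Prod>i<n. principal_minor a (S i)) = of_real (\<Prod>i<n. Re (principal_minor a (S i))) \<and>
      0 < (\<Prod>i<n. Re (principal_minor a (S i)))" if "S \<in> ordered_partitions d n \<alpha>" for S
  proof -
    have "0 < principal_minor a (S i)" if "i < n" for i
      using \<open>S \<in> _\<close> that by (intro pos_def_principal_minor_pos[OF assms(1)]) (auto simp: ordered_partitions_def)
    then have "principal_minor a (S i) = of_real (Re (principal_minor a (S i)))" "Re (principal_minor a (S i)) > 0"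
      if "i < n" for i using that by (simp_all add: less_complex_def complex_eq_iff)
    then show ?thesis by (auto simp only: of_real_prod lessThan_iff intro!: prod.cong prod_pos)
  qed
  then have "fischer_minors d n a \<alpha> =
      of_real (\<Sum>S\<in>ordered_partitions d n \<alpha>. \<Prod>i<n. Re (principal_minor a (S i)))"
    and "0 < (\<Sum>S\<in>ordered_partitions d n \<alpha>. \<Prod>i<n. Re (principal_minor a (S i)))"
    unfolding fischer_minors_def
    by (auto intro!: sum_pos finite_ordered_partitions ordered_partitions_nonempty assms(2))
  then show ?thesis by (simp only: less_complex_def Re_complex_of_real Im_complex_of_real zero_complex.sel)
qed

text \<open>This is \<open>slot_sum_nonzero\<close> with L the set of all indices: the weights keep
  the tuples that contain each index exactly once, which are the ordered partitions, and grouping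
  them by block sizes produces the monomials.\<close>

lemma fischer_generating_function_nonzero:
  assumes "pos_def d a" "n \<ge> 1" "\<And>i. i < n \<Longrightarrow> Im (z i) > 0"
  shows "(\<Sum>\<alpha>\<in>compositions n d. (\<Prod>i<n. z i ^ \<alpha> i) * fischer_minors d n a \<alpha>) \<noteq> 0"
proof -
  let ?F = "{..<n} \<rightarrow>\<^sub>E Pow {..<d}"
  let ?t = "\<lambda>S. \<Prod>i<n. z i ^ card (S i) * principal_minor a (S i)"
  let ?P = "{S \<in> ?F. \<forall>j<d. card {i\<in>{..<n}. j \<in> S i} = 1}"
  have fin: "finite ?F" by (intro finite_PiE) auto
  have part: "S \<in> ordered_partitions d n \<alpha> \<longleftrightarrow> S \<in> ?P \<and> (\<forall>i<n. card (S i) = \<alpha> i)" for S \<alpha>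
  proof -
    have eq: "(\<forall>j<d. card {i\<in>{..<n}. j \<in> S i} = 1) \<longleftrightarrow> disjoint_family_on S {..<n} \<and> (\<Union>i<n. S i) = {..<d}"
      if S: "S \<in> ?F"
    proof -
      have sub: "S i \<subseteq> {..<d}" if "i < n" for i using S that by auto
      have "card {i\<in>{..<n}. j \<in> S i} = 1 \<longleftrightarrow> (\<exists>!i. i < n \<and> j \<in> S i)" for j
        by (auto simp: card_1_singleton_iff set_eq_iff Ex1_def)
      then have "(\<forall>j<d. card {i\<in>{..<n}. j \<in> S i} = 1) \<longleftrightarrow> (\<forall>j<d. \<exists>!i. i < n \<and> j \<in> S i)" by simp
      also have "\<dots> \<longleftrightarrow> disjoint_family_on S {..<n} \<and> (\<Union>i<n. S i) = {..<d}"
      proof (intro iffI conjI)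
        assume u: "\<forall>j<d. \<exists>!i. i < n \<and> j \<in> S i"
        show "disjoint_family_on S {..<n}"
        proof (unfold disjoint_family_on_def, intro ballI impI, rule ccontr)
          fix i k assume ik: "i \<in> {..<n}" "k \<in> {..<n}" "i \<noteq> k" "S i \<inter> S k \<noteq> {}"
          then obtain j where "j \<in> S i" "j \<in> S k" by blast
          moreover then have "j < d" using sub ik by auto
          ultimately show False using u ik by auto
        qed
        show "(\<Union>i<n. S i) = {..<d}" using u sub by blast
      next
        assume r: "disjoint_family_on S {..<n} \<and> (\<Union>i<n. S i) = {..<d}"
        show "\<forall>j<d. \<exists>!i. i < n \<and> j \<in> S i"
        proof (intro allI impI)
          fix j assume "j < d"
          then obtain i where "i < n" "j \<in> S i" using r by auto
          then show "\<exists>!i. i < n \<and> j \<in> S i"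
            using r unfolding disjoint_family_on_def by (intro ex1I[of _ i]) auto
        qed
      qed
      finally show ?thesis .
    qed
    show ?thesis
    proof (cases "S \<in> ?F")
      case True
      then show ?thesis by (simp only: ordered_partitions_def mem_Collect_eq eq[OF True] conj_assoc simp_thms)
    qed (simp only: ordered_partitions_def mem_Collect_eq simp_thms)
  qed
  have "slot_sum n a {..<d} z (\<lambda>j. if j \<in> {..<d} then (\<lambda>c. of_bool (c = 1)) else (\<lambda>c. 0 ^ c * 1 ^ (n - c))) \<noteq> 0"
    by (rule slot_sum_nonzero) (use assms in auto)
  also have "slot_sum n a {..<d} z (\<lambda>j. if j \<in> {..<d} then (\<lambda>c. of_bool (c = 1)) else (\<lambda>c. 0 ^ c * 1 ^ (n - c))) =
      (\<Sum>S\<in>?F. if \<forall>j<d. card {i\<in>{..<n}. j \<in> S i} = 1 then ?t S else 0)"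
    unfolding slot_sum_def
  proof (rule sum.cong[OF refl])
    fix S assume "S \<in> ?F"
    have "(\<Prod>j<d. of_bool (card {i\<in>{..<n}. j \<in> S i} = 1) :: complex) = of_bool (\<forall>j<d. card {i\<in>{..<n}. j \<in> S i} = 1)"
      by (auto intro!: prod.neutral prod_zero)
    then show "?t S * (\<Prod>j<d. (if j \<in> {..<d} then (\<lambda>c. of_bool (c = 1)) else (\<lambda>c. 0 ^ c * 1 ^ (n - c)))
        (card {i\<in>{..<n}. j \<in> S i})) = (if \<forall>j<d. card {i\<in>{..<n}. j \<in> S i} = 1 then ?t S else 0)"
      using \<open>S \<in> ?F\<close> by simp
  qed
  also have "\<dots> = (\<Sum>S\<in>?P. ?t S)" by (rule sum.inter_filter[OF fin, symmetric])
  also have "\<dots> = (\<Sum>\<alpha>\<in>compositions n d. \<Sum>S\<in>{S\<in>?P. (\<lambda>i. if i < n then card (S i) else 0) = \<alpha>}. ?t S)"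
  proof (rule sum.group[symmetric])
    show "finite ?P" using fin by simp
    show "(\<lambda>S i. if i < n then card (S i) else 0) ` ?P \<subseteq> compositions n d"
    proof safe
      fix S assume S: "S \<in> ?F" "\<forall>j<d. card {i\<in>{..<n}. j \<in> S i} = 1"
      then have "S \<in> ordered_partitions d n (\<lambda>i. card (S i))" using part[of S] by blast
      then have r: "disjoint_family_on S {..<n}" "(\<Union>i<n. S i) = {..<d}" by (auto simp: ordered_partitions_def)
      have "finite (S i)" if "i < n" for i using S(1) that by (auto intro: finite_subset)
      then have "card (\<Union>i<n. S i) = (\<Sum>i<n. card (S i))"
        using r(1) by (intro card_UN_disjoint) (auto simp: disjoint_family_on_def)
      then show "(\<lambda>i. if i < n then card (S i) else 0) \<in> compositions n d"
        using r(2) by (simp add: compositions_def)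
    qed
  qed (rule finite_compositions)
  also have "\<dots> = (\<Sum>\<alpha>\<in>compositions n d. (\<Prod>i<n. z i ^ \<alpha> i) * fischer_minors d n a \<alpha>)"
  proof (rule sum.cong[OF refl])
    fix \<alpha> assume \<alpha>: "\<alpha> \<in> compositions n d"
    have eq: "{S\<in>?P. (\<lambda>i. if i < n then card (S i) else 0) = \<alpha>} = ordered_partitions d n \<alpha>"
      using \<alpha> unfolding set_eq_iff part by (auto simp: compositions_def fun_eq_iff)
    have t: "?t S = (\<Prod>i<n. z i ^ \<alpha> i) * (\<Prod>i<n. principal_minor a (S i))"
      if "S \<in> ordered_partitions d n \<alpha>" for S
      using that by (simp add: part prod.distrib)
    show "(\<Sum>S\<in>{S\<in>?P. (\<lambda>i. if i < n then card (S i) else 0) = \<alpha>}. ?t S) =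
        (\<Prod>i<n. z i ^ \<alpha> i) * fischer_minors d n a \<alpha>"
      unfolding fischer_minors_def sum_distrib_left by (rule sum.cong[OF eq t])
  qed
  finally show ?thesis .
qed

lemma ordered_partitions_cong:
  "(\<And>i. i < n \<Longrightarrow> \<alpha> i = \<beta> i) \<Longrightarrow> ordered_partitions d n \<alpha> = ordered_partitions d n \<beta>"
  by (simp add: ordered_partitions_def cong: conj_cong)

text \<open>The T of the overview. \<open>Re\<close> makes it real-valued and loses nothing for
  Hermitian matrices, whose principal minors are real.\<close>

definition fischer_weight :: "nat \<Rightarrow> nat \<Rightarrow> (nat \<Rightarrow> nat \<Rightarrow> complex) \<Rightarrow> (nat \<Rightarrow> nat) \<Rightarrow> real" where
  "fischer_weight d n a \<alpha> = (\<Prod>i<n. fact (\<alpha> i)) * Re (fischer_minors d n a \<alpha>)"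

lemma fischer_weight_cong:
  "(\<And>i. i < n \<Longrightarrow> \<alpha> i = \<beta> i) \<Longrightarrow> fischer_weight d n a \<alpha> = fischer_weight d n a \<beta>"
  using ordered_partitions_cong[of n \<alpha> \<beta>] by (simp add: fischer_weight_def fischer_minors_def)

lemma fischer_weight_pos:
  assumes "pos_def d a" "(\<Sum>i<n. \<alpha> i) = d"
  shows "fischer_weight d n a \<alpha> > 0"
  using fischer_minors_pos[OF assms] by (auto simp: fischer_weight_def less_complex_def intro!: mult_pos_pos prod_pos)

text \<open>The factor \<alpha>! in the weight cancels the denominator of the multinomial
  coefficient, so the weighted sum is d! times the generating function.\<close>

lemma fischer_weight_log_concave:
  assumes a: "pos_def d a" and n: "n \<ge> 1"
  shows "log_concave_on d n (fischer_weight d n a)"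
proof (rule stable_imp_log_concave)
  show "fischer_weight d n a \<alpha> > 0" if "(\<Sum>l<n. \<alpha> l) = d" for \<alpha>
    using a that by (rule fischer_weight_pos)
  show "fischer_weight d n a \<alpha> = fischer_weight d n a \<beta>" if "\<And>l. l < n \<Longrightarrow> \<alpha> l = \<beta> l" for \<alpha> \<beta>
    using that by (rule fischer_weight_cong)
  fix z :: "nat \<Rightarrow> complex" assume z: "\<And>l. l < n \<Longrightarrow> Im (z l) > 0"
  have "weighted_sum n (\<lambda>\<alpha>. of_real (fischer_weight d n a \<alpha>)) d (\<lambda>_. 0) z =
      (\<Sum>\<alpha>\<in>compositions n d. fact d * ((\<Prod>i<n. z i ^ \<alpha> i) * fischer_minors d n a \<alpha>))"
    unfolding weighted_sum_eq
  proof (rule sum.cong[OF refl])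
    fix \<alpha> assume "\<alpha> \<in> compositions n d"
    then have "0 < fischer_minors d n a \<alpha>" by (intro fischer_minors_pos[OF a]) (simp add: compositions_def)
    then have "of_real (Re (fischer_minors d n a \<alpha>)) = fischer_minors d n a \<alpha>"
      by (simp add: less_complex_def complex_eq_iff)
    then have "complex_of_real (fischer_weight d n a \<alpha>) = (\<Prod>i<n. fact (\<alpha> i)) * fischer_minors d n a \<alpha>"
      by (simp add: fischer_weight_def of_real_prod)
    then show "fact d / (\<Prod>i<n. fact (\<alpha> i)) * (\<Prod>i<n. z i ^ \<alpha> i) * of_real (fischer_weight d n a (\<lambda>i. 0 + \<alpha> i)) =
        fact d * ((\<Prod>i<n. z i ^ \<alpha> i) * fischer_minors d n a \<alpha>)"
      by simp
  qed
  also have "\<dots> \<noteq> 0"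
    using fischer_generating_function_nonzero[OF a n z] by (simp add: sum_distrib_left[symmetric])
  finally show "weighted_sum n (\<lambda>\<alpha>. of_real (fischer_weight d n a \<alpha>)) d (\<lambda>_. 0) z \<noteq> 0" .
qed

section \<open>Majorization\<close>

text \<open>The ratios of successive terms do not increase, so an ascent at \<open>k\<close> would
  propagate to all smaller indices. As s - (k + 1) \<le> k, the term at s - (k + 1) would be smaller
  than the one at k + 1, against symmetry.\<close>

lemma log_concave_symmetric_decreasing:
  fixes c :: "nat \<Rightarrow> real"
  assumes pos: "\<And>k. k \<le> s \<Longrightarrow> c k > 0"
    and sym: "\<And>k. k \<le> s \<Longrightarrow> c (s - k) = c k"
    and lc: "\<And>k. k + 2 \<le> s \<Longrightarrow> c k * c (k + 2) \<le> (c (k + 1))\<^sup>2"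
    and k: "s \<le> 2 * k + 1" "k < s"
  shows "c (k + 1) \<le> c k"
proof (rule ccontr)
  assume "\<not> ?thesis"
  have inc: "c (k - m) < c (k - m + 1)" if "m \<le> k" for m
    using that
  proof (induction m)
    case 0
    then show ?case using \<open>\<not> c (k + 1) \<le> c k\<close> by simp
  next
    case (Suc m)
    define l where "l = k - Suc m"
    have l: "k - m = l + 1" "l + 2 \<le> s" using Suc.prems k by (auto simp: l_def)
    have "c l * c (l + 2) \<le> c (l + 1) * c (l + 1)" using lc[OF l(2)] by (simp add: power2_eq_square)
    also have "\<dots> < c (l + 1) * c (l + 2)" using Suc l pos[of "l + 1"] by simp
    finally have "c l < c (l + 1)" using pos[OF l(2)] by (simp add: mult.commute)
    then show ?case by (simp add: l_def)
  qed
  have less: "c a < c (k + 1)" if "a \<le> k" for a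
    using that
  proof (induction "k - a" arbitrary: a)
    case 0
    then show ?case using inc[of 0] by simp
  next
    case (Suc m)
    then have "c (a + 1) < c (k + 1)" by simp
    moreover have "c a < c (a + 1)" using inc[of "k - a"] Suc by simp
    ultimately show ?case by simp
  qed
  have "c (s - (k + 1)) < c (k + 1)" using k by (intro less) auto
  then show False using sym[of "k + 1"] k by simp
qed

text \<open>Fixing the sum s of entries i and j leaves a log-concave sequence, symmetric because the
  two entries may be swapped.\<close>

lemma log_concave_on_transfer:
  fixes T :: "(nat \<Rightarrow> nat) \<Rightarrow> real"
  assumes lc: "log_concave_on d n T"
    and pos: "\<And>\<alpha>. (\<Sum>l<n. \<alpha> l) = d \<Longrightarrow> T \<alpha> > 0"
    and sym: "\<And>\<alpha> p. p permutes {..<n} \<Longrightarrow> T (\<lambda>i. \<alpha> (p i)) = T \<alpha>"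
    and \<alpha>: "(\<Sum>l<n. \<alpha> l) = d" and ij: "i < n" "j < n" "\<alpha> j < \<alpha> i"
  shows "T \<alpha> \<le> T (\<alpha>(i := \<alpha> i - 1, j := \<alpha> j + 1))"
proof -
  have "i \<noteq> j" using ij by auto
  define s where "s = \<alpha> i + \<alpha> j"
  define b where "b x y = \<alpha>(i := x, j := y)" for x y
  have sum_b: "(\<Sum>l<n. b x y l) = d" if "x + y = s" for x y
  proof -
    have "(\<Sum>l<n. f l) = f i + (f j + (\<Sum>l\<in>{..<n} - {i} - {j}. f l))" for f :: "nat \<Rightarrow> nat"
      using ij \<open>i \<noteq> j\<close> by (simp add: sum.remove[of "{..<n}" i] sum.remove[of "{..<n} - {i}" j])
    moreover have "(\<Sum>l\<in>{..<n} - {i} - {j}. b x y l) = (\<Sum>l\<in>{..<n} - {i} - {j}. \<alpha> l)"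
      by (rule sum.cong) (auto simp: b_def)
    ultimately show ?thesis using \<alpha> that \<open>i \<noteq> j\<close> by (simp add: b_def s_def)
  qed
  \<comment> \<open>For k = \<open>\<alpha> i - 1\<close> the condition s \<le> 2 k + 1 says exactly
    that \<open>\<alpha> j < \<alpha> i\<close>.\<close>
  have "T (b (\<alpha> i - 1 + 1) (s - (\<alpha> i - 1 + 1))) \<le> T (b (\<alpha> i - 1) (s - (\<alpha> i - 1)))"
  proof (rule log_concave_symmetric_decreasing[where c = "\<lambda>k. T (b k (s - k))" and s = s])
    show "0 < T (b k (s - k))" if "k \<le> s" for k using that by (intro pos sum_b) simp
    show "T (b (s - k) (s - (s - k))) = T (b k (s - k))" if "k \<le> s" for k
    proof -
      have "Transposition.transpose i j permutes {..<n}" using ij by (intro permutes_swap_id) auto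
      then have "T (\<lambda>l. b k (s - k) (Transposition.transpose i j l)) = T (b k (s - k))" by (rule sym)
      moreover have "(\<lambda>l. b k (s - k) (Transposition.transpose i j l)) = b (s - k) (s - (s - k))"
        using that \<open>i \<noteq> j\<close> by (auto simp: b_def fun_eq_iff Transposition.transpose_def)
      ultimately show ?thesis by simp
    qed
    show "T (b k (s - k)) * T (b (k + 2) (s - (k + 2))) \<le> (T (b (k + 1) (s - (k + 1))))\<^sup>2" if k: "k + 2 \<le> s" for k
    proof -
      define \<gamma> where "\<gamma> = b k (s - (k + 2))"
      have e: "\<gamma>(i := \<gamma> i + 2) = b (k + 2) (s - (k + 2))" "\<gamma>(j := \<gamma> j + 2) = b k (s - k)"
        "\<gamma>(i := \<gamma> i + 1, j := \<gamma> j + 1) = b (k + 1) (s - (k + 1))"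
        using \<open>i \<noteq> j\<close> k by (auto simp: \<gamma>_def b_def fun_eq_iff)
      have "(\<Sum>l<n. \<gamma> l) + 2 = (\<Sum>l<n. (\<gamma>(i := \<gamma> i + 2)) l)" by (rule sum_fun_upd_add[OF ij(1), symmetric])
      also have "\<dots> = d" unfolding e(1) using k by (intro sum_b) simp
      finally have "(\<Sum>l<n. \<gamma> l) + 2 = d" .
      then have "T (\<gamma>(i := \<gamma> i + 2)) * T (\<gamma>(j := \<gamma> j + 2)) \<le> (T (\<gamma>(i := \<gamma> i + 1, j := \<gamma> j + 1)))\<^sup>2"
        using lc ij \<open>i \<noteq> j\<close> unfolding log_concave_on_def by blast
      then show ?thesis unfolding e by (simp only: mult.commute)
    qed
  qed (use ij in \<open>auto simp: s_def\<close>)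
  moreover have "b (\<alpha> i - 1 + 1) (s - (\<alpha> i - 1 + 1)) = \<alpha>"
    using ij by (auto simp: b_def s_def fun_eq_iff)
  moreover have "b (\<alpha> i - 1) (s - (\<alpha> i - 1)) = \<alpha>(i := \<alpha> i - 1, j := \<alpha> j + 1)"
    using ij by (auto simp: b_def s_def fun_eq_iff)
  ultimately show ?thesis by simp
qed

section \<open>Majorization by unit transfers\<close>

text \<open>Induction on the total excess of the partial sums of \<alpha> over those of \<beta>:
  while the two differ, some unit transfer lowers the excess, preserves domination and does not
  decrease \<open>T\<close>.\<close>

lemma partial_sums_dominated_le:
  fixes T :: "(nat \<Rightarrow> nat) \<Rightarrow> real"
  assumes tr: "\<And>\<alpha> i j. (\<Sum>l<n. \<alpha> l) = d \<Longrightarrow> i < n \<Longrightarrow> j < n \<Longrightarrow> \<alpha> j < \<alpha> i \<Longrightarrow>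
      T \<alpha> \<le> T (\<alpha>(i := \<alpha> i - 1, j := \<alpha> j + 1))"
    and cong: "\<And>\<alpha> \<beta>. (\<And>l. l < n \<Longrightarrow> \<alpha> l = \<beta> l) \<Longrightarrow> T \<alpha> = T \<beta>"
    and anti: "\<And>i j. i \<le> j \<Longrightarrow> j < n \<Longrightarrow> \<beta> j \<le> \<beta> i"
    and "(\<Sum>l<n. \<alpha> l) = d" "(\<Sum>l<n. \<beta> l) = d"
    and "\<And>k. k \<le> n \<Longrightarrow> (\<Sum>l<k. \<beta> l) \<le> (\<Sum>l<k. \<alpha> l)"
  shows "T \<alpha> \<le> T \<beta>"
  using assms(4,6)
proof (induction "\<Sum>k\<le>n. (\<Sum>l<k. \<alpha> l) - (\<Sum>l<k. \<beta> l)" arbitrary: \<alpha> rule: less_induct)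
  case less
  show ?case
  proof (cases "\<forall>l<n. \<alpha> l = \<beta> l")
    case True
    then show ?thesis using cong[of \<alpha> \<beta>] by simp
  next
    case False
    define i where "i = (LEAST i. i < n \<and> \<alpha> i \<noteq> \<beta> i)"
    have i: "i < n" "\<alpha> i \<noteq> \<beta> i"
      using False LeastI_ex[of "\<lambda>i. i < n \<and> \<alpha> i \<noteq> \<beta> i"] unfolding i_def by blast+
    have "\<alpha> l = \<beta> l" if "l < i" for l
      using not_less_Least[of l "\<lambda>i. i < n \<and> \<alpha> i \<noteq> \<beta> i"] that i(1) unfolding i_def by fastforce
    then have eq: "(\<Sum>l<i. \<alpha> l) = (\<Sum>l<i. \<beta> l)" by (intro sum.cong) auto
    then have \<alpha>i: "\<alpha> i > \<beta> i" using less.prems(2)[of "Suc i"] i by simp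
    \<comment> \<open>Only \<open>\<beta>\<close> is sorted: moving a unit from \<open>i\<close> to \<open>j = m - 1\<close> lowers exactly the partial sums that
      strictly exceed those of \<open>\<beta>\<close>, so that \<open>\<alpha>\<close> need not be kept sorted.\<close>
    define m where "m = (LEAST m. i < m \<and> m \<le> n \<and> (\<Sum>l<m. \<alpha> l) = (\<Sum>l<m. \<beta> l))"
    have "i < n \<and> n \<le> n \<and> (\<Sum>l<n. \<alpha> l) = (\<Sum>l<n. \<beta> l)"
      using i less.prems(1) assms(5) by simp
    then have m: "i < m" "m \<le> n" "(\<Sum>l<m. \<alpha> l) = (\<Sum>l<m. \<beta> l)"
      using LeastI[of "\<lambda>m. i < m \<and> m \<le> n \<and> (\<Sum>l<m. \<alpha> l) = (\<Sum>l<m. \<beta> l)" n] unfolding m_def by blast+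
    have strict: "(\<Sum>l<k. \<beta> l) < (\<Sum>l<k. \<alpha> l)" if "i < k" "k < m" for k
      using not_less_Least[of k "\<lambda>m. i < m \<and> m \<le> n \<and> (\<Sum>l<m. \<alpha> l) = (\<Sum>l<m. \<beta> l)"]
        less.prems(2)[of k] that m unfolding m_def by fastforce
    have "m \<noteq> Suc i" using m(3) eq \<alpha>i by auto
    then obtain j where j: "m = Suc j" "i < j" using m(1) by (cases m) auto
    \<comment> \<open>The excess is positive before entry j and zero after it. Then
      \<open>\<alpha> j\<close> < \<open>\<beta> j\<close> \<le> \<open>\<beta> i\<close> <
      \<open>\<alpha> i\<close>, so the transfer goes from a larger to a smaller entry.\<close>
    have "\<alpha> j < \<beta> j" using strict[of j] m(3) j by simp
    then have ij: "\<alpha> j < \<alpha> i" using anti[of i j] \<alpha>i j m(2) by simp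
    define \<alpha>' where "\<alpha>' = \<alpha>(i := \<alpha> i - 1, j := \<alpha> j + 1)"
    have part: "(\<Sum>l<k. \<alpha>' l) + (if i < k \<and> k \<le> j then 1 else 0) = (\<Sum>l<k. \<alpha> l)" for k
    proof (induction k)
      case (Suc k)
      then show ?case using j ij by (cases "k = i"; cases "k = j") (auto simp: \<alpha>'_def split: if_splits)
    qed simp
    have sum': "(\<Sum>l<n. \<alpha>' l) = d" using part[of n] less.prems(1) j m(2) by simp
    have dom: "(\<Sum>l<k. \<beta> l) \<le> (\<Sum>l<k. \<alpha>' l)" if "k \<le> n" for k
      using part[of k] strict[of k] less.prems(2)[OF that] j by (auto split: if_splits)
    have "T \<alpha> \<le> T \<alpha>'" unfolding \<alpha>'_def
      by (rule tr) (use less.prems(1) i j m(2) ij in auto)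
    also have "T \<alpha>' \<le> T \<beta>"
    proof (rule less.hyps[OF _ sum' dom])
      show "(\<Sum>k\<le>n. (\<Sum>l<k. \<alpha>' l) - (\<Sum>l<k. \<beta> l)) < (\<Sum>k\<le>n. (\<Sum>l<k. \<alpha> l) - (\<Sum>l<k. \<beta> l))"
      proof (rule sum_strict_mono_ex1)
        show "\<forall>k\<in>{..n}. (\<Sum>l<k. \<alpha>' l) - (\<Sum>l<k. \<beta> l) \<le> (\<Sum>l<k. \<alpha> l) - (\<Sum>l<k. \<beta> l)"
        proof
          fix k show "(\<Sum>l<k. \<alpha>' l) - (\<Sum>l<k. \<beta> l) \<le> (\<Sum>l<k. \<alpha> l) - (\<Sum>l<k. \<beta> l)"
            using part[of k] by (intro diff_le_mono) linarith
        qed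
        \<comment> \<open>At k = j the excess is positive, so that the truncated difference really
          drops.\<close>
        show "\<exists>k\<in>{..n}. (\<Sum>l<k. \<alpha>' l) - (\<Sum>l<k. \<beta> l) < (\<Sum>l<k. \<alpha> l) - (\<Sum>l<k. \<beta> l)"
          using part[of j] strict[of j] j m by (intro bexI[of _ j]) auto
      qed simp
    qed
    finally show ?thesis .
  qed
qed

lemma decreasing_rearrangement_permutation:
  obtains p where "p permutes {..<n}" "\<And>i. i < n \<Longrightarrow> decreasing_rearrangement n w i = w (p i)"
proof -
  have "mset (rev (sort (map w [0..<n]))) = mset (map w [0..<n])" by simp
  then obtain p where p: "p permutes {..<length (map w [0..<n])}"
    "permute_list p (map w [0..<n]) = rev (sort (map w [0..<n]))"
    by (rule mset_eq_permutation)
  have p': "p permutes {..<n}" using p(1) by simp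
  have "decreasing_rearrangement n w i = w (p i)" if i: "i < n" for i
  proof -
    have "p i < n" using permutes_in_image[OF p', of i] i by simp
    then show ?thesis
      unfolding decreasing_rearrangement_def p(2)[symmetric] using p(1) i by (subst permute_list_nth) auto
  qed
  then show ?thesis using p' that by blast
qed

lemma decreasing_rearrangement_antimono:
  assumes "i \<le> j" "j < n"
  shows "decreasing_rearrangement n w j \<le> decreasing_rearrangement n w i"
  unfolding decreasing_rearrangement_def
  using assms by (intro sorted_rev_nth_mono) auto

text \<open>Symmetry of \<open>T\<close> allows both vectors to be replaced by their decreasing
  rearrangements, for which majorization is domination of partial sums.\<close>

lemma majorized_by_imp_le:
  fixes T :: "(nat \<Rightarrow> nat) \<Rightarrow> real"
  assumes lc: "log_concave_on d n T"
    and pos: "\<And>\<alpha>. (\<Sum>l<n. \<alpha> l) = d \<Longrightarrow> T \<alpha> > 0"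
    and sym: "\<And>\<alpha> p. p permutes {..<n} \<Longrightarrow> T (\<lambda>i. \<alpha> (p i)) = T \<alpha>"
    and cong: "\<And>\<alpha> \<beta>. (\<And>l. l < n \<Longrightarrow> \<alpha> l = \<beta> l) \<Longrightarrow> T \<alpha> = T \<beta>"
    and \<alpha>: "(\<Sum>l<n. \<alpha> l) = d" and \<beta>: "(\<Sum>l<n. \<beta> l) = d"
    and maj: "majorized_by n (\<lambda>i. real (\<beta> i)) (\<lambda>i. real (\<alpha> i))"
  shows "T \<alpha> \<le> T \<beta>"
proof -
  obtain p where p: "p permutes {..<n}"
    "\<And>i. i < n \<Longrightarrow> decreasing_rearrangement n (\<lambda>i. real (\<alpha> i)) i = real (\<alpha> (p i))"
    using decreasing_rearrangement_permutation[of n "\<lambda>i. real (\<alpha> i)"] by metis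
  obtain q where q: "q permutes {..<n}"
    "\<And>i. i < n \<Longrightarrow> decreasing_rearrangement n (\<lambda>i. real (\<beta> i)) i = real (\<beta> (q i))"
    using decreasing_rearrangement_permutation[of n "\<lambda>i. real (\<beta> i)"] by metis
  have "T (\<lambda>i. \<alpha> (p i)) \<le> T (\<lambda>i. \<beta> (q i))"
  proof (rule partial_sums_dominated_le[where d = d and n = n])
    show "T \<alpha>' \<le> T (\<alpha>'(i := \<alpha>' i - 1, j := \<alpha>' j + 1))"
      if "(\<Sum>l<n. \<alpha>' l) = d" "i < n" "j < n" "\<alpha>' j < \<alpha>' i" for \<alpha>' i j
      using lc pos sym that by (rule log_concave_on_transfer)
    show "T \<alpha>' = T \<beta>'" if "\<And>l. l < n \<Longrightarrow> \<alpha>' l = \<beta>' l" for \<alpha>' \<beta>'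
      using that by (rule cong)
    show "\<beta> (q j) \<le> \<beta> (q i)" if "i \<le> j" "j < n" for i j
      using decreasing_rearrangement_antimono[OF that, of "\<lambda>i. real (\<beta> i)"] that q(2) by simp
    show "(\<Sum>l<n. \<alpha> (p l)) = d" using sum.permute[OF p(1), of \<alpha>] \<alpha> by (simp add: o_def)
    show "(\<Sum>l<n. \<beta> (q l)) = d" using sum.permute[OF q(1), of \<beta>] \<beta> by (simp add: o_def)
    show "(\<Sum>l<k. \<beta> (q l)) \<le> (\<Sum>l<k. \<alpha> (p l))" if k: "k \<le> n" for k
    \<comment> \<open>\<open>majorized_by\<close> compares partial sums from k = 1 on; for k = 0
      both sums are empty.\<close>
    proof (cases "k = 0")
      case False
      then have "(\<Sum>l<k. decreasing_rearrangement n (\<lambda>i. real (\<beta> i)) l)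
          \<le> (\<Sum>l<k. decreasing_rearrangement n (\<lambda>i. real (\<alpha> i)) l)"
        using maj k unfolding majorized_by_def by auto
      moreover have "(\<Sum>l<k. decreasing_rearrangement n (\<lambda>i. real (\<beta> i)) l) = real (\<Sum>l<k. \<beta> (q l))"
        using q(2) k by simp
      moreover have "(\<Sum>l<k. decreasing_rearrangement n (\<lambda>i. real (\<alpha> i)) l) = real (\<Sum>l<k. \<alpha> (p l))"
        using p(2) k by simp
      ultimately show ?thesis by (simp only: of_nat_le_iff)
    qed simp
  qed
  then show ?thesis using sym p(1) q(1) by simp
qed

section \<open>Fischer weights under permutations, and log-concavity along shifts\<close>

text \<open>Renumbering the slots by \<open>p\<close> matches the tuples for the two size vectors
  and only reorders the factors.\<close>

lemma fischer_weight_permute: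
  assumes p: "p permutes {..<n}"
  shows "fischer_weight d n a (\<lambda>i. \<alpha> (p i)) = fischer_weight d n a \<alpha>"
proof -
  have mem: "S \<circ> p \<in> ordered_partitions d n (\<lambda>i. \<alpha> (p i))"
    if p: "p permutes {..<n}" and S: "S \<in> ordered_partitions d n \<alpha>" for p S and \<alpha> :: "nat \<Rightarrow> nat"
  proof -
    have lt: "p i < n" if "i < n" for i using permutes_in_image[OF p, of i] that by simp
    have S1: "S \<in> {..<n} \<rightarrow>\<^sub>E Pow {..<d}" and S2: "disjoint_family_on S {..<n}"
      and S3: "(\<Union>i<n. S i) = {..<d}" and S4: "\<forall>i<n. card (S i) = \<alpha> i"
      using S by (auto simp: ordered_partitions_def)
    have "S \<circ> p \<in> {..<n} \<rightarrow>\<^sub>E Pow {..<d}"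
    proof (rule PiE_I)
      show "(S \<circ> p) i \<in> Pow {..<d}" if "i \<in> {..<n}" for i using that lt[of i] S1 by auto
      show "(S \<circ> p) i = undefined" if "i \<notin> {..<n}" for i
        using that S1 p by (simp add: permutes_not_in PiE_arb[OF S1])
    qed
    moreover have "disjoint_family_on (S \<circ> p) {..<n}"
      using S2 lt inj_eq[OF permutes_inj[OF p]] by (auto simp: disjoint_family_on_def)
    moreover have "(\<Union>i<n. (S \<circ> p) i) = {..<d}"
      using S3 permutes_image[OF p] by (simp flip: image_image)
    ultimately show ?thesis using S4 lt by (simp add: ordered_partitions_def)
  qed
  have pinv: "inv_into UNIV p permutes {..<n}" using p by (rule permutes_inv)
  have "fischer_minors d n a (\<lambda>i. \<alpha> (p i)) = fischer_minors d n a \<alpha>"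
    unfolding fischer_minors_def
  proof (rule sum.reindex_bij_witness[of _ "\<lambda>S. S \<circ> p" "\<lambda>S. S \<circ> inv_into UNIV p"])
    fix S assume S: "S \<in> ordered_partitions d n (\<lambda>i. \<alpha> (p i))"
    show "S \<circ> inv_into UNIV p \<circ> p = S" using p by (simp add: fun_eq_iff permutes_inverses)
    show "S \<circ> inv_into UNIV p \<in> ordered_partitions d n \<alpha>"
      using mem[OF pinv S] p by (simp add: permutes_inverses)
    show "(\<Prod>i<n. principal_minor a ((S \<circ> inv_into UNIV p) i)) = (\<Prod>i<n. principal_minor a (S i))"
      using prod.permute[OF pinv, of "\<lambda>i. principal_minor a (S i)"] by (simp add: o_def)
  next
    fix S assume S: "S \<in> ordered_partitions d n \<alpha>"
    show "S \<circ> p \<circ> inv_into UNIV p = S" using p by (simp add: fun_eq_iff permutes_inverses)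
    show "S \<circ> p \<in> ordered_partitions d n (\<lambda>i. \<alpha> (p i))" using mem[OF p S] .
  qed
  moreover have "(\<Prod>i<n. fact (\<alpha> (p i)) :: real) = (\<Prod>i<n. fact (\<alpha> i))"
    using prod.permute[OF p, of "\<lambda>i. fact (\<alpha> i) :: real"] by (simp add: o_def)
  ultimately show ?thesis by (simp add: fischer_weight_def)
qed

lemma log_concave_on_shift:
  fixes T :: "(nat \<Rightarrow> nat) \<Rightarrow> real"
  assumes lc: "log_concave_on d n T"
    and "i < n" "j < n" "(\<Sum>l<n. \<alpha> l) = d" "- int (\<alpha> i) + 1 \<le> k" "k \<le> int (\<alpha> j) - 1"
  shows "T (shift \<alpha> (k - 1) i j) * T (shift \<alpha> (k + 1) i j) \<le> (T (shift \<alpha> k i j))\<^sup>2"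
proof (cases "i = j")
  case True
  \<comment> \<open>The unit vectors cancel, so all three points are \<alpha>.\<close>
  then show ?thesis by (simp add: shift_def power2_eq_square)
next
  case False
  \<comment> \<open>The common lower point \<alpha> + k (e_i - e_j) - e_i - e_j; the bounds on
    \<open>k\<close> say that its entries i and j are nonnegative.\<close>
  define \<gamma> where "\<gamma> = \<alpha>(i := nat (int (\<alpha> i) + k - 1), j := nat (int (\<alpha> j) - k - 1))"
  have e: "\<gamma>(i := \<gamma> i + 2) = shift \<alpha> (k + 1) i j" "\<gamma>(j := \<gamma> j + 2) = shift \<alpha> (k - 1) i j"
    "\<gamma>(i := \<gamma> i + 1, j := \<gamma> j + 1) = shift \<alpha> k i j"
    using False assms(5,6) by (auto simp: \<gamma>_def shift_def unit_vector_def fun_eq_iff)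
  have split: "(\<Sum>l<n. f l) = f i + (f j + (\<Sum>l\<in>{..<n} - {i} - {j}. f l))" for f :: "nat \<Rightarrow> nat"
    using assms(2,3) False by (simp add: sum.remove[of "{..<n}" i] sum.remove[of "{..<n} - {i}" j])
  have "(\<Sum>l\<in>{..<n} - {i} - {j}. \<gamma> l) = (\<Sum>l\<in>{..<n} - {i} - {j}. \<alpha> l)"
    by (rule sum.cong) (auto simp: \<gamma>_def)
  moreover have "\<gamma> i + \<gamma> j + 2 = \<alpha> i + \<alpha> j" using False assms(5,6) by (simp add: \<gamma>_def)
  ultimately have "(\<Sum>l<n. \<gamma> l) + 2 = d" using split[of \<gamma>] split[of \<alpha>] assms(4) by simp
  then have "T (\<gamma>(i := \<gamma> i + 2)) * T (\<gamma>(j := \<gamma> j + 2)) \<le> (T (\<gamma>(i := \<gamma> i + 1, j := \<gamma> j + 1)))\<^sup>2"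
    using lc assms(2,3) False unfolding log_concave_on_def by blast
  then show ?thesis unfolding e by (simp only: mult.commute)
qed

section \<open>From positive definite to semidefinite matrices\<close>

text \<open>The perturbation adds \<epsilon> times the squared norm of \<open>v\<close> to the
  Hermitian form.\<close>

lemma positive_semidefinite_perturb:
  assumes A: "A \<in> carrier_mat d d" "positive_semidefinite A" and "\<epsilon> > 0"
  shows "pos_def d (\<lambda>i j. A $$ (i, j) + of_real \<epsilon> * of_bool (i = j))"
  unfolding pos_def_def
proof (intro conjI allI impI)
  have adj: "mat_adjoint A = A" using A by (simp add: positive_semidefinite_def)
  fix i j assume ij: "i < d" "j < d"
  have "mat_adjoint A $$ (j, i) = cnj (A $$ (i, j))"
    using A(1) ij unfolding mat_adjoint_def by (simp add: mat_of_rows_index)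
  then show "A $$ (j, i) + of_real \<epsilon> * of_bool (j = i) = cnj (A $$ (i, j) + of_real \<epsilon> * of_bool (i = j))"
    using adj by auto
next
  fix v :: "nat \<Rightarrow> complex" assume v: "\<exists>j<d. v j \<noteq> 0"
  let ?v = "vec d v"
  have "(A *\<^sub>v ?v) \<bullet>c ?v = (\<Sum>j<d. (\<Sum>k<d. A $$ (j, k) * v k) * cnj (v j))"
    using A(1) by (simp add: scalar_prod_def atLeast0LessThan)
  also have "\<dots> = (\<Sum>j<d. \<Sum>k<d. cnj (v j) * A $$ (j, k) * v k)"
    by (simp add: sum_distrib_left mult_ac)
  finally have 1: "0 \<le> (\<Sum>j<d. \<Sum>k<d. cnj (v j) * A $$ (j, k) * v k)"
    using A by (auto simp: positive_semidefinite_def dest!: bspec[of _ _ ?v])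
  obtain j where j: "j < d" "v j \<noteq> 0" using v by auto
  have "0 < (\<Sum>j<d. (cmod (v j))\<^sup>2)"
    by (rule sum_pos2[of _ j]) (use j in auto)
  then have 2: "0 < complex_of_real (\<epsilon> * (\<Sum>j<d. (cmod (v j))\<^sup>2))"
    using assms(3) by (simp add: less_complex_def)
  have "(\<Sum>k<d. cnj (v j) * (A $$ (j, k) + of_real \<epsilon> * of_bool (j = k)) * v k) =
      (\<Sum>k<d. cnj (v j) * A $$ (j, k) * v k) + of_real (\<epsilon> * (cmod (v j))\<^sup>2)" if "j < d" for j
  proof -
    have "(\<Sum>k<d. cnj (v j) * (of_real \<epsilon> * of_bool (j = k)) * v k) =
        (\<Sum>k<d. if k = j then of_real \<epsilon> * (v j * cnj (v j)) else 0)"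
      by (rule sum.cong) auto
    also have "\<dots> = of_real \<epsilon> * (v j * cnj (v j))" using that by simp
    also have "\<dots> = of_real (\<epsilon> * (cmod (v j))\<^sup>2)" by (simp only: of_real_mult complex_norm_square)
    finally show ?thesis by (simp add: ring_distribs sum.distrib)
  qed
  then have "(\<Sum>j<d. \<Sum>k<d. cnj (v j) * (A $$ (j, k) + of_real \<epsilon> * of_bool (j = k)) * v k) =
      (\<Sum>j<d. \<Sum>k<d. cnj (v j) * A $$ (j, k) * v k) + of_real (\<epsilon> * (\<Sum>j<d. (cmod (v j))\<^sup>2))"
    by (simp add: sum.distrib sum_distrib_left)
  then show "0 < (\<Sum>j<d. \<Sum>k<d. cnj (v j) * (A $$ (j, k) + of_real \<epsilon> * of_bool (j = k)) * v k)"
    using add_nonneg_pos[OF 1 2] by simp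
qed

lemma fischer_weight_tendsto:
  "((\<lambda>\<epsilon>. fischer_weight d n (\<lambda>i j. a i j + of_real \<epsilon> * of_bool (i = j)) \<alpha>)
     \<longlongrightarrow> fischer_weight d n a \<alpha>) (at_right 0)"
proof -
  have "((\<lambda>\<epsilon>. a i j + of_real \<epsilon> * of_bool (i = j)) \<longlongrightarrow> a i j) (at_right 0)" for i j
  proof -
    have "((\<lambda>\<epsilon>. a i j + of_real \<epsilon> * of_bool (i = j)) \<longlongrightarrow> a i j + of_real 0 * of_bool (i = j)) (at_right 0)"
      by (intro tendsto_intros)
    then show ?thesis by simp
  qed
  then show ?thesis
    unfolding fischer_weight_def fischer_minors_def principal_minor_def by (intro tendsto_intros)
qed

text \<open>The inverse multinomial coefficient is \<alpha>!/d!, and the Fischer sum of a Hermitian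
  matrix equals its real part.\<close>

lemma avg_fischer_product_eq_weight:
  assumes A: "A \<in> carrier_mat d d" "positive_semidefinite A" and \<alpha>: "(\<Sum>i<n. \<alpha> i) = d"
  shows "avg_fischer_product n \<alpha> A = of_real (fischer_weight d n (\<lambda>i j. A $$ (i, j)) \<alpha> / fact d)"
proof -
  let ?a = "\<lambda>i j. A $$ (i, j)"
  have herm: "A $$ (j, i) = cnj (A $$ (i, j))" if "i < d" "j < d" for i j
  proof -
    have "mat_adjoint A $$ (j, i) = cnj (A $$ (i, j))"
      using A(1) that unfolding mat_adjoint_def by (simp add: mat_of_rows_index)
    then show ?thesis using A(2) by (simp add: positive_semidefinite_def)
  qed
  have sub: "S i \<subseteq> {..<d}" if "S \<in> ordered_partitions d n \<alpha>" "i < n" for S i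
    using that by (auto simp: ordered_partitions_def)
  have real: "principal_minor ?a (S i) = of_real (Re (principal_minor ?a (S i)))"
    if "S \<in> ordered_partitions d n \<alpha>" "i < n" for S i
  proof -
    have "Im (principal_minor ?a (S i)) = 0"
      by (rule principal_minor_real[OF finite_subset[OF sub[OF that]] herm]) (use sub[OF that] in auto)
    then show ?thesis by (simp add: complex_eq_iff)
  qed
  have "(\<Prod>i<n. principal_minor ?a (S i)) = of_real (\<Prod>i<n. Re (principal_minor ?a (S i)))"
    if "S \<in> ordered_partitions d n \<alpha>" for S
    unfolding of_real_prod by (rule prod.cong[OF refl]) (use real[OF that] in simp)
  then have "fischer_minors d n ?a \<alpha> =
      of_real (\<Sum>S\<in>ordered_partitions d n \<alpha>. \<Prod>i<n. Re (principal_minor ?a (S i)))"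
    unfolding fischer_minors_def of_real_sum by (rule sum.cong[OF refl])
  then have re: "fischer_minors d n ?a \<alpha> = of_real (Re (fischer_minors d n ?a \<alpha>))"
    by (simp only: Re_complex_of_real)
  have "fischer_sum n \<alpha> A = fischer_minors d n ?a \<alpha>"
    unfolding fischer_sum_def fischer_minors_def using A(1) sub
    by (auto intro!: sum.cong prod.cong det_submatrix_principal_minor)
  also note re
  finally show ?thesis
    using \<alpha> by (simp add: avg_fischer_product_def multinomial_def fischer_weight_def of_real_prod field_simps)
qed

theorem corollary3p5:
  fixes A :: "complex mat" and d n :: nat
  assumes "A \<in> carrier_mat d d"
    and "positive_semidefinite A"
    and "n \<ge> 1"
  shows "(\<forall>\<alpha> \<beta> :: nat \<Rightarrow> nat.
            (\<Sum>i<n. \<alpha> i) = d \<and> (\<Sum>i<n. \<beta> i) = d \<and>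
            majorized_by n (\<lambda>i. real (\<beta> i)) (\<lambda>i. real (\<alpha> i)) \<longrightarrow>
            avg_fischer_product n \<alpha> A \<le> avg_fischer_product n \<beta> A) \<and>
         (\<forall>(\<alpha> :: nat \<Rightarrow> nat) i j (k :: int).
            i < n \<and> j < n \<and> (\<Sum>l<n. \<alpha> l) = d \<and> \<alpha> i \<ge> \<alpha> j \<and> \<alpha> j > 0 \<and>
            - int (\<alpha> i) + 1 \<le> k \<and> k \<le> int (\<alpha> j) - 1 \<longrightarrow>
            (avg_fischer_product n (shift \<alpha> k i j) A)\<^sup>2
              \<ge> avg_fischer_product n (shift \<alpha> (k - 1) i j) A
                 * avg_fischer_product n (shift \<alpha> (k + 1) i j) A)"
proof (intro conjI allI impI; elim conjE)
  define a where "a \<epsilon> i j = A $$ (i, j) + of_real \<epsilon> * of_bool (i = j)" for \<epsilon> :: real and i j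
  define w where "w = fischer_weight d n (\<lambda>i j. A $$ (i, j))"
  have pd: "pos_def d (a \<epsilon>)" if "\<epsilon> > 0" for \<epsilon>
    unfolding a_def using assms(1,2) that by (rule positive_semidefinite_perturb)
  have lim: "((\<lambda>\<epsilon>. fischer_weight d n (a \<epsilon>) \<alpha>) \<longlongrightarrow> w \<alpha>) (at_right 0)" for \<alpha>
    unfolding a_def w_def by (rule fischer_weight_tendsto)
  have avg: "avg_fischer_product n \<alpha> A = of_real (w \<alpha> / fact d)" if "(\<Sum>l<n. \<alpha> l) = d" for \<alpha>
    unfolding w_def using assms(1,2) that by (rule avg_fischer_product_eq_weight)
  have of_real_le: "complex_of_real x \<le> complex_of_real y" if "x \<le> y" for x y
    using that by (simp add: less_eq_complex_def)
  {
    fix \<alpha> \<beta> :: "nat \<Rightarrow> nat"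
    assume \<alpha>: "(\<Sum>i<n. \<alpha> i) = d" and \<beta>: "(\<Sum>i<n. \<beta> i) = d"
      and maj: "majorized_by n (\<lambda>i. real (\<beta> i)) (\<lambda>i. real (\<alpha> i))"
    have "fischer_weight d n (a \<epsilon>) \<alpha> \<le> fischer_weight d n (a \<epsilon>) \<beta>" if "\<epsilon> > 0" for \<epsilon>
      using fischer_weight_log_concave[OF pd[OF that] assms(3)] fischer_weight_pos[OF pd[OF that]]
        fischer_weight_permute fischer_weight_cong \<alpha> \<beta> maj
      by (rule majorized_by_imp_le)
    \<comment> \<open>The weights of A itself may vanish, but the weak inequality survives the limit
      \<epsilon> to 0.\<close>
    then have "w \<alpha> \<le> w \<beta>"
      by (intro tendsto_le[OF _ lim lim]) (auto intro: eventually_mono[OF eventually_at_right_less])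
    then show "avg_fischer_product n \<alpha> A \<le> avg_fischer_product n \<beta> A"
      unfolding avg[OF \<alpha>] avg[OF \<beta>] by (intro of_real_le divide_right_mono) auto
  }
  {
    fix \<alpha> :: "nat \<Rightarrow> nat" and i j and k :: int
    assume ij: "i < n" "j < n" and \<alpha>: "(\<Sum>l<n. \<alpha> l) = d"
      and k: "- int (\<alpha> i) + 1 \<le> k" "k \<le> int (\<alpha> j) - 1"
    have "fischer_weight d n (a \<epsilon>) (shift \<alpha> (k - 1) i j) * fischer_weight d n (a \<epsilon>) (shift \<alpha> (k + 1) i j)
        \<le> (fischer_weight d n (a \<epsilon>) (shift \<alpha> k i j))\<^sup>2" if "\<epsilon> > 0" for \<epsilon>
      using fischer_weight_log_concave[OF pd[OF that] assms(3)] ij \<alpha> k by (rule log_concave_on_shift)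
    then have le: "w (shift \<alpha> (k - 1) i j) * w (shift \<alpha> (k + 1) i j) \<le> (w (shift \<alpha> k i j))\<^sup>2"
      by (intro tendsto_le[OF _ tendsto_power[OF lim] tendsto_mult[OF lim lim]])
        (auto intro: eventually_mono[OF eventually_at_right_less])
    \<comment> \<open>The values k - 1, k and k + 1 all lie in this range, where \<open>nat\<close>
      truncates nothing in \<open>shift\<close> and the total stays d.\<close>
    have sum: "(\<Sum>l<n. shift \<alpha> m i j l) = d" if "- int (\<alpha> i) \<le> m" "m \<le> int (\<alpha> j)" for m
    proof -
      have "int (\<Sum>l<n. shift \<alpha> m i j l) = (\<Sum>l<n. int (\<alpha> l) + m * (unit_vector i l - unit_vector j l))"
        using that unfolding of_nat_sum shift_def
        by (intro sum.cong) (auto simp: unit_vector_def)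
      also have "\<dots> = int d + m * ((\<Sum>l<n. unit_vector i l) - (\<Sum>l<n. unit_vector j l))"
        by (simp add: sum.distrib sum_subtractf flip: sum_distrib_left \<alpha>)
      also have "\<dots> = int d" using ij by (simp add: unit_vector_def)
      finally show ?thesis by (simp only: of_nat_eq_iff)
    qed
    have "w (shift \<alpha> (k - 1) i j) / fact d * (w (shift \<alpha> (k + 1) i j) / fact d) \<le> (w (shift \<alpha> k i j) / fact d)\<^sup>2"
      using le by (simp add: power_divide power2_eq_square divide_right_mono)
    from of_real_le[OF this]
    show "avg_fischer_product n (shift \<alpha> (k - 1) i j) A * avg_fischer_product n (shift \<alpha> (k + 1) i j) A
        \<le> (avg_fischer_product n (shift \<alpha> k i j) A)\<^sup>2"
      using k by (simp add: avg sum)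
  }
qed

end
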